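(* Let $m\geq 2$ and $n\geq m+2$ be integers. Let $F=F(x_1,\dots,x_m)$ be a positive smooth function on the torus $T^m$, let $\epsilon>0$, and consider the Riemannian metric on $S^{n-m}\times T^m$ $$g=\epsilon^2F^2h+F^{-2\frac{n-m}{m-1}}\sum_{i=1}^m dx_i^2,$$ where $h$ is the standard (round, unit) metric on $S^{n-m}$. Let $e_i=\frac{\partial}{\partial x_i}\big/\big|\frac{\partial}{\partial x_i}\big|_g$ for $1\leq i\leq m$. Then the $m$-intermediate curvature of $g$ satisfies $$\mathcal{C}_m(e_1,\dots,e_m)=(n-m)\Big[\frac{(n-m)(m-2)}{2(m-1)}-1\Big]F^{2\frac{n-m}{m-1}-2}\sum_{i=1}^m\Big(\frac{\partial F}{\partial x_i}\Big)^2 .$$ If $n(m-2)\geq m^2-2$ and $\epsilon$ is sufficiently small (depending on the $C^2$ norm of $\log F$), then $g$ satisfies $\mathcal{C}_m\geq 0$ everywhere. If further $n(m-2)>m^2-2$, then (for such $\epsilon$) $\mathcal{C}_m>0$ at all non-critical points of $F$, i.e. $\mathcal{C}_m(X_1,\dots,X_m)>0$ for every orthonormal frame at every point $(y,q)\in S^{n-m}\times T^m$ with $dF(q)\neq 0$.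
   Context: $T^m=\mathbb{R}^m/\mathbb{Z}^m$ is the torus with its natural (periodic) coordinates $x_1,\dots,x_m$; norms of derivatives of $\log F$ are taken in these coordinates. For a Riemannian $n$-manifold, $1\leq m\leq n-1$, and an orthonormal frame $\{e_1,\dots,e_n\}$ at a point, the $m$-intermediate curvature is $$\mathcal{C}_m(e_1,\dots,e_m):=\sum_{p=1}^m\sum_{q=p+1}^n R(e_p,e_q,e_q,e_p),$$ where $R(e_p,e_q,e_q,e_p)$ is the sectional curvature of the plane spanned by $e_p,e_q$. It depends only on the span of $e_1,\dots,e_m$. The metric satisfies $\mathcal{C}_m\geq\lambda$ (respectively $\mathcal{C}_m>0$) at a point if $\mathcal{C}_m(e_1,\dots,e_m)\geq\lambda$ (respectively $>0$) for every orthonormal frame at that point. *)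

theory Defs
  imports "HOL-Analysis.Analysis"
begin

section \<open>Smooth functions\<close>

fun cont_diff :: "nat \<Rightarrow> ('a::euclidean_space \<Rightarrow> real) \<Rightarrow> bool" where
  "cont_diff 0 f \<longleftrightarrow> continuous_on UNIV f"
| "cont_diff (Suc r) f \<longleftrightarrow>
     (\<forall>x. f differentiable (at x)) \<and>
     (\<forall>b\<in>Basis. cont_diff r (\<lambda>x. frechet_derivative f (at x) b))"

definition smooth :: "('a::euclidean_space \<Rightarrow> real) \<Rightarrow> bool" where
  "smooth f \<longleftrightarrow> (\<forall>r. cont_diff r f)"


section \<open>Curvature of a metric in a coordinate domain\<close>

text \<open>A metric in coordinates is a map \<open>G\<close>, where \<open>G x u v\<close> is the inner product at \<open>x\<close> of the
  coordinate vectors \<open>u\<close> and \<open>v\<close>. A fixed vector \<open>u\<close> is also read as the constant vector field,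
  so that \<open>christoffel G x u v\<close> is the covariant derivative of \<open>v\<close> in the direction \<open>u\<close> for the
  Levi-Civita connection, as given by the Koszul formula (constant fields commute).\<close>

definition christoffel :: "('a \<Rightarrow> 'a \<Rightarrow> 'a \<Rightarrow> real) \<Rightarrow> 'a \<Rightarrow> 'a \<Rightarrow> 'a \<Rightarrow> 'a::euclidean_space" where
  "christoffel G x u v = (THE w. \<forall>z.
     G x w z = (frechet_derivative (\<lambda>x. G x v z) (at x) u
              + frechet_derivative (\<lambda>x. G x u z) (at x) v
              - frechet_derivative (\<lambda>x. G x u v) (at x) z) / 2)"

text \<open>\<open>R(u,v)w = \<nabla>\<^sub>u\<nabla>\<^sub>v w - \<nabla>\<^sub>v\<nabla>\<^sub>u w\<close> for constant fields.\<close>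

definition curvature_op ::
  "('a \<Rightarrow> 'a \<Rightarrow> 'a \<Rightarrow> real) \<Rightarrow> 'a \<Rightarrow> 'a \<Rightarrow> 'a \<Rightarrow> 'a \<Rightarrow> 'a::euclidean_space" where
  "curvature_op G x u v w =
       frechet_derivative (\<lambda>x. christoffel G x v w) (at x) u
     - frechet_derivative (\<lambda>x. christoffel G x u w) (at x) v
     + christoffel G x u (christoffel G x v w)
     - christoffel G x v (christoffel G x u w)"

text \<open>With this convention \<open>curvature_tensor G x u v v u\<close> is the sectional curvature of the plane
  spanned by \<open>u\<close> and \<open>v\<close> when these are orthonormal.\<close>

definition curvature_tensor ::
  "('a \<Rightarrow> 'a \<Rightarrow> 'a \<Rightarrow> real) \<Rightarrow> 'a \<Rightarrow> 'a \<Rightarrow> 'a \<Rightarrow> 'a \<Rightarrow> 'a::euclidean_space \<Rightarrow> real" where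
  "curvature_tensor G x u v w z = G x (curvature_op G x u v w) z"


section \<open>The torus\<close>

definition torus_rel :: "(real^'m) rel" where
  "torus_rel = {(x, y). \<forall>i. x $ i - y $ i \<in> \<int>}"

definition torus :: "(real^'m) set set" where
  "torus = UNIV // torus_rel"

definition torus_pt :: "real^'m \<Rightarrow> (real^'m) set" where
  "torus_pt x = torus_rel `` {x}"

definition torus_smooth :: "((real^'m) set \<Rightarrow> real) \<Rightarrow> bool" where
  "torus_smooth f \<longleftrightarrow> smooth (\<lambda>x. f (torus_pt x))"

text \<open>The partial derivative in the periodic coordinate \<open>x\<^sub>i\<close>. By periodicity of the lift it does not
  depend on the representative.\<close>

definition torus_partial :: "'m::finite \<Rightarrow> ((real^'m) set \<Rightarrow> real) \<Rightarrow> (real^'m) set \<Rightarrow> real" where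
  "torus_partial i f q =
     frechet_derivative (\<lambda>x. f (torus_pt x)) (at (SOME x. x \<in> q)) (axis i 1)"

definition C2_norm :: "((real^'m::finite) set \<Rightarrow> real) \<Rightarrow> real" where
  "C2_norm f = (SUP q\<in>torus. \<bar>f q\<bar>)
     + (\<Sum>i\<in>UNIV. SUP q\<in>torus. \<bar>torus_partial i f q\<bar>)
     + (\<Sum>i\<in>UNIV. \<Sum>j\<in>UNIV. SUP q\<in>torus. \<bar>torus_partial i (torus_partial j f) q\<bar>)"


section \<open>The product of a sphere and a torus\<close>

text \<open>The unit sphere of dimension \<open>k = CARD('k)\<close> sits in \<open>real^'k \<times> real\<close>, a Euclidean space of
  dimension \<open>k + 1\<close>. A tangent vector at \<open>(y, q)\<close> is a pair \<open>(u, v)\<close>, where \<open>u\<close> is orthogonal to \<open>y\<close>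
  and \<open>v\<close> lists the components with respect to the coordinate fields of the torus.\<close>

type_synonym ('k, 'm) point = "((real^'k) \<times> real) \<times> (real^'m) set"
type_synonym ('k, 'm) vect = "((real^'k) \<times> real) \<times> (real^'m)"

definition sphere_torus :: "('k::finite, 'm::finite) point set" where
  "sphere_torus = sphere 0 1 \<times> torus"

definition tangent_space :: "('k::finite, 'm::finite) point \<Rightarrow> ('k, 'm) vect set" where
  "tangent_space p = {X. fst X \<bullet> fst p = 0}"

definition coord_vect :: "'m::finite \<Rightarrow> ('k::finite, 'm) vect" where
  "coord_vect i = (0, axis i 1)"

text \<open>Inverse stereographic projection from the pole \<open>(0, \<sigma>)\<close>, where \<open>\<sigma> = 1\<close> or \<open>\<sigma> = -1\<close>.\<close>

definition stereo :: "real \<Rightarrow> real^'k::finite \<Rightarrow> (real^'k) \<times> real" where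
  "stereo \<sigma> s = ((2 / (1 + (norm s)\<^sup>2)) *\<^sub>R s, \<sigma> * (((norm s)\<^sup>2 - 1) / ((norm s)\<^sup>2 + 1)))"

text \<open>Local parametrizations of the product. Together they cover it. They are defined on all
  of \<open>real^'k \<times> real^'m\<close> and are local diffeomorphisms. Their differentials are \<open>dchart\<close>.\<close>

definition chart :: "real \<Rightarrow> (real^'k) \<times> (real^'m) \<Rightarrow> ('k::finite, 'm::finite) point" where
  "chart \<sigma> z = (stereo \<sigma> (fst z), torus_pt (snd z))"

definition dchart ::
  "real \<Rightarrow> (real^'k) \<times> (real^'m) \<Rightarrow> (real^'k) \<times> (real^'m) \<Rightarrow> ('k::finite, 'm::finite) vect" where
  "dchart \<sigma> z a = (frechet_derivative (stereo \<sigma>) (at (fst z)) (fst a), snd a)"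


section \<open>Intermediate curvature\<close>

type_synonym ('k, 'm) metric =
  "('k, 'm) point \<Rightarrow> ('k, 'm) vect \<Rightarrow> ('k, 'm) vect \<Rightarrow> real"

text \<open>The curvature tensor is computed in some parametrization around \<open>p\<close>. The choice does not matter,
  since curvature is invariant under changes of coordinates.\<close>

definition riemann ::
  "('k::finite, 'm::finite) metric \<Rightarrow> ('k, 'm) point \<Rightarrow>
     ('k, 'm) vect \<Rightarrow> ('k, 'm) vect \<Rightarrow> ('k, 'm) vect \<Rightarrow> ('k, 'm) vect \<Rightarrow> real" where
  "riemann g p X Y Z W =
     (let (\<sigma>, z) = (SOME (\<sigma>, z). \<sigma> \<in> {1, -1} \<and> chart \<sigma> z = p);
          c = inv (dchart \<sigma> z)
      in curvature_tensor (\<lambda>z a b. g (chart \<sigma> z) (dchart \<sigma> z a) (dchart \<sigma> z b)) z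
           (c X) (c Y) (c Z) (c W))"

definition orthonormal_frame ::
  "('k::finite, 'm::finite) metric \<Rightarrow> ('k, 'm) point \<Rightarrow> nat \<Rightarrow> (nat \<Rightarrow> ('k, 'm) vect) \<Rightarrow> bool" where
  "orthonormal_frame g p n e \<longleftrightarrow>
     (\<forall>i\<in>{1..n}. e i \<in> tangent_space p) \<and>
     (\<forall>i\<in>{1..n}. \<forall>j\<in>{1..n}. g p (e i) (e j) = (if i = j then 1 else 0))"

text \<open>\<open>n\<close> is the dimension of the manifold and \<open>e\<close> an orthonormal frame, of which \<open>e 1, \<dots>, e m\<close>
  are the arguments of the intermediate curvature.\<close>

definition intermediate_curvature ::
  "('k::finite, 'm::finite) metric \<Rightarrow> ('k, 'm) point \<Rightarrow> nat \<Rightarrow> nat \<Rightarrow> (nat \<Rightarrow> ('k, 'm) vect) \<Rightarrow> real"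
  where
  "intermediate_curvature g p n m e =
     (\<Sum>i=1..m. \<Sum>j=i+1..n. riemann g p (e i) (e j) (e j) (e i))"

definition curvature_ge ::
  "('k::finite, 'm::finite) metric \<Rightarrow> ('k, 'm) point \<Rightarrow> nat \<Rightarrow> nat \<Rightarrow> real \<Rightarrow> bool" where
  "curvature_ge g p n m c \<longleftrightarrow>
     (\<forall>e. orthonormal_frame g p n e \<longrightarrow> intermediate_curvature g p n m e \<ge> c)"

definition curvature_pos ::
  "('k::finite, 'm::finite) metric \<Rightarrow> ('k, 'm) point \<Rightarrow> nat \<Rightarrow> nat \<Rightarrow> bool" where
  "curvature_pos g p n m \<longleftrightarrow>
     (\<forall>e. orthonormal_frame g p n e \<longrightarrow> intermediate_curvature g p n m e > 0)"


section \<open>The warped metric\<close>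

text \<open>The round metric is the restriction of the Euclidean inner product to tangent vectors of the
  unit sphere.\<close>

definition warped_metric ::
  "nat \<Rightarrow> nat \<Rightarrow> real \<Rightarrow> ((real^'m) set \<Rightarrow> real) \<Rightarrow> ('k::finite, 'm::finite) metric" where
  "warped_metric n m \<epsilon> F p X Y =
     \<epsilon>\<^sup>2 * (F (snd p))\<^sup>2 * (fst X \<bullet> fst Y)
     + F (snd p) powr (-2 * ((real n - real m) / (real m - 1))) *
         (\<Sum>i\<in>UNIV. snd X $ i * snd Y $ i)"

end

theory Submission
  imports Defs
begin

text \<open>Write \<open>f = ln F\<close>, \<open>k = n - m\<close> and \<open>c = k / (m - 1)\<close>. In stereographic coordinates \<open>s\<close> on the sphere and periodic
coordinates \<open>x\<close> on the torus the metric is \<open>e\<^sup>2\<^sup>\<alpha> |ds|\<^sup>2 + e\<^sup>2\<^sup>\<beta> |dx|\<^sup>2\<close>, where \<open>\<alpha> = ln \<epsilon> + ln (2 / (1 + |s|\<^sup>2)) + f(x)\<close>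
and \<open>\<beta> = - c f(x)\<close>. For metrics of this kind the curvature can be computed in closed form (\<open>sectional\<close>). In an
orthonormal frame with spherical components \<open>a\<^sub>i\<close> and toral components \<open>b\<^sub>i\<close>, the curvature of the plane spanned by
the \<open>i\<close>-th and \<open>j\<close>-th vectors is
\<open>\<kappa> (|a\<^sub>i|\<^sup>2 |a\<^sub>j|\<^sup>2 - (a\<^sub>i \<bullet> a\<^sub>j)\<^sup>2)\<close>
minus terms built from two bilinear forms \<open>T\<close> and \<open>H\<close> on the torus (\<open>sectional_chart\<close>). The forms are
made from first and second derivatives of \<open>f\<close>, and \<open>\<epsilon>\<close> enters only through \<open>\<kappa> = 1 / (\<epsilon> F)\<^sup>2 - e\<^sup>2\<^sup>c\<^sup>f |\<nabla>f|\<^sup>2\<close>.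

If the first \<open>m\<close> frame vectors span the tangent space of the torus, the intermediate curvature is
\<open>- e\<^sup>2\<^sup>c\<^sup>f ((m - 1) tr T + k tr H)\<close>. The exponent \<open>c\<close> is the one for which the Laplacian of \<open>f\<close> drops out of
this combination, and the multiple of \<open>|\<nabla>f|\<^sup>2\<close> that is left is the asserted formula (\<open>trace_forms\<close>).

For a general frame let the tilt \<open>S\<close> be the sum of \<open>|a\<^sub>p|\<^sup>2\<close> over \<open>p \<le> m\<close>. The terms with \<open>T\<close> and \<open>H\<close> then change by at
most a constant times \<open>S\<close>, the constant depending on the \<open>C\<^sup>2\<close> norm of \<open>f\<close> (\<open>base_part\<close>). There is no term of the
order of the square root of \<open>S\<close>, and this is what makes the argument work. On the other hand the terms with \<open>\<kappa>\<close>
contribute at least \<open>\<kappa> (k - 1) S / 2\<close> (\<open>spherical_part\<close>). As \<open>k \<ge> 2\<close>, and as \<open>\<kappa>\<close> is large for small \<open>\<epsilon>\<close>, this gain exceeds the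
loss. So the intermediate curvature of every frame is bounded below by the value
for the torus directions, which is nonnegative, respectively positive where \<open>F\<close> is not critical.\<close>

section \<open>Bilinear forms in curvature formulas\<close>

text \<open>The value on \<open>(u, v, v, u)\<close> of the Kulkarni--Nomizu product of a bilinear form \<open>T\<close>
with an inner product. The two factors are evaluated on separate vectors, \<open>T\<close> on \<open>u, v\<close> and the inner
product on \<open>a, a'\<close>, because the curvature terms of a warped product pair a form on the base
with the inner product of the fibre.\<close>

definition kulkarni_nomizu :: "('c::real_inner \<Rightarrow> 'c \<Rightarrow> real) \<Rightarrow> ('d::real_inner) \<Rightarrow> 'd \<Rightarrow> 'c \<Rightarrow> 'c \<Rightarrow> real" where
  "kulkarni_nomizu T a a' u v = T u u * (a' \<bullet> a') + T v v * (a \<bullet> a) - 2 * T u v * (a \<bullet> a')"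

text \<open>For \<open>g\<close> and \<open>H\<close> the gradient and Hessian of \<open>\<psi>\<close>, this is minus the Schouten tensor
(in dimension at least three) of the conformally flat metric \<open>e\<^sup>2\<^sup>\<psi> |dx|\<^sup>2\<close>: its product with
the Euclidean inner product is, up to the factor \<open>- e\<^sup>2\<^sup>\<psi>\<close>, the curvature of that metric.\<close>

definition schouten :: "('c \<Rightarrow> 'c) \<Rightarrow> 'c::real_inner \<Rightarrow> 'c \<Rightarrow> 'c \<Rightarrow> real" where
  "schouten H g u v = H u \<bullet> v - (g \<bullet> u) * (g \<bullet> v) + (g \<bullet> g) / 2 * (u \<bullet> v)"

text \<open>For \<open>g, H\<close> the gradient and Hessian of \<open>f\<close> and \<open>h\<close> the gradient of \<open>b\<close>, this is
\<open>e\<^sup>-\<^sup>f\<close> times the Hessian of the warping function \<open>e\<^sup>f\<close> for the metric \<open>e\<^sup>2\<^sup>b |dx|\<^sup>2\<close>.\<close>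

definition warp_hess :: "('c \<Rightarrow> 'c) \<Rightarrow> 'c \<Rightarrow> 'c \<Rightarrow> 'c::real_inner \<Rightarrow> 'c \<Rightarrow> real" where
  "warp_hess H g h u v = H u \<bullet> v + (g \<bullet> u) * (g \<bullet> v)
     - (g \<bullet> u) * (h \<bullet> v) - (h \<bullet> u) * (g \<bullet> v) + (g \<bullet> h) * (u \<bullet> v)"

lemma bilinear_schouten: "linear H \<Longrightarrow> bilinear (schouten H g)"
  unfolding bilinear_def schouten_def
  by (auto simp: linear_iff inner_simps algebra_simps)

lemma bilinear_warp_hess: "linear H \<Longrightarrow> bilinear (warp_hess H g h)"
  unfolding bilinear_def warp_hess_def
  by (auto simp: linear_iff inner_simps algebra_simps)

lemma kulkarni_nomizu_scale:
  assumes "bilinear T"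
  shows "kulkarni_nomizu T (x *\<^sub>R a) (x *\<^sub>R a') (y *\<^sub>R u) (y *\<^sub>R v) = x\<^sup>2 * y\<^sup>2 * kulkarni_nomizu T a a' u v"
  by (simp add: kulkarni_nomizu_def bilinear_lmul[OF assms] bilinear_rmul[OF assms] power2_eq_square algebra_simps)

section \<open>Orthonormal bases of a product space\<close>

text \<open>An orthonormal family whose size is the dimension spans, so the difference of the two sides
is orthogonal to itself.\<close>

lemma orthonormal_expansion:
  fixes v :: "'i \<Rightarrow> 'c::euclidean_space"
  assumes on: "\<And>i j. i \<in> I \<Longrightarrow> j \<in> I \<Longrightarrow> v i \<bullet> v j = (if i = j then 1 else 0)"
    and I: "finite I" "card I = DIM('c)"
  shows "(\<Sum>i\<in>I. (v i \<bullet> x) *\<^sub>R v i) = x"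
proof -
  have inj: "inj_on v I"
    by (rule inj_onI) (metis on zero_neq_one)
  have "pairwise orthogonal (v ` I)"
    by (auto simp: pairwise_def orthogonal_def on)
  moreover have "0 \<notin> v ` I" using on by fastforce
  ultimately have ind: "independent (v ` I)" by (rule pairwise_orthogonal_independent)
  have "card (v ` I) = DIM('c)" by (simp add: card_image inj I)
  hence span: "span (v ` I) = UNIV"
    using ind by (metis card_eq_dim dim_UNIV finite_imageI I(1) subset_UNIV top.extremum_uniqueI)
  define d where "d = x - (\<Sum>i\<in>I. (v i \<bullet> x) *\<^sub>R v i)"
  have "orthogonal d y" if y: "y \<in> v ` I" for y
  proof -
    from y obtain j where j: "j \<in> I" "y = v j" by auto
    have "(\<Sum>i\<in>I. (v i \<bullet> x) * (v i \<bullet> v j)) = (\<Sum>i\<in>I. if i = j then v j \<bullet> x else 0)"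
      by (rule sum.cong) (use on j in auto)
    thus ?thesis
      using j I by (simp add: d_def orthogonal_def inner_diff_left inner_sum_left inner_commute[of x])
  qed
  hence "orthogonal d d" using orthogonal_to_span[of d "v ` I" d] span by auto
  thus ?thesis by (simp add: d_def orthogonal_def)
qed

lemma parseval:
  fixes v :: "'i \<Rightarrow> 'c::euclidean_space"
  assumes on: "\<And>i j. i \<in> I \<Longrightarrow> j \<in> I \<Longrightarrow> v i \<bullet> v j = (if i = j then 1 else 0)"
    and I: "finite I" "card I = DIM('c)"
  shows "(\<Sum>i\<in>I. (v i \<bullet> x) * (v i \<bullet> y)) = x \<bullet> y"
proof -
  have "x \<bullet> y = (\<Sum>i\<in>I. (v i \<bullet> x) *\<^sub>R v i) \<bullet> y"
    by (subst orthonormal_expansion[OF on I]) auto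
  thus ?thesis by (simp add: inner_sum_left)
qed

text \<open>Expand the first \<open>v i\<close> in the standard basis and sum over \<open>i\<close> before summing over the basis:
the second argument then becomes the expansion of a basis vector in the family.\<close>

lemma trace_orthonormal:
  fixes v :: "'i \<Rightarrow> 'c::euclidean_space" and T :: "'c \<Rightarrow> 'c \<Rightarrow> real"
  assumes T: "bilinear T"
    and on: "\<And>i j. i \<in> I \<Longrightarrow> j \<in> I \<Longrightarrow> v i \<bullet> v j = (if i = j then 1 else 0)"
    and I: "finite I" "card I = DIM('c)"
  shows "(\<Sum>i\<in>I. T (v i) (v i)) = (\<Sum>e\<in>Basis. T e e)"
proof -
  have l: "linear (\<lambda>x. T x y)" and r: "linear (T y)" for y
    using T by (auto simp: bilinear_def)
  have "T (v i) (v i) = (\<Sum>e\<in>Basis. (v i \<bullet> e) * T e (v i))" for i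
  proof -
    have "T (v i) (v i) = T (\<Sum>e\<in>Basis. (v i \<bullet> e) *\<^sub>R e) (v i)"
      by (simp add: euclidean_representation)
    thus ?thesis by (simp add: linear_sum[OF l] linear_cmul[OF l])
  qed
  hence "(\<Sum>i\<in>I. T (v i) (v i)) = (\<Sum>e\<in>Basis. \<Sum>i\<in>I. (v i \<bullet> e) * T e (v i))"
    by (subst sum.swap) simp
  also have "\<dots> = (\<Sum>e\<in>Basis. T e (\<Sum>i\<in>I. (v i \<bullet> e) *\<^sub>R v i))"
    by (simp add: linear_sum[OF r] linear_cmul[OF r])
  also have "\<dots> = (\<Sum>e\<in>Basis. T e e)"
    by (simp add: orthonormal_expansion[OF on I])
  finally show ?thesis .
qed

lemma sum_pairs_additive:
  fixes t :: "nat \<Rightarrow> real"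
  shows "(\<Sum>p=1..m. \<Sum>q=p+1..m. t p + t q) = (real m - 1) * (\<Sum>p=1..m. t p)"
proof (induction m)
  case (Suc m)
  have "(\<Sum>p=1..Suc m. \<Sum>q=p+1..Suc m. t p + t q)
      = (\<Sum>p=1..m. (\<Sum>q=p+1..m. t p + t q) + (t p + t (Suc m)))"
    by (simp)
  also have "\<dots> = (real m - 1) * (\<Sum>p=1..m. t p) + (\<Sum>p=1..m. t p) + real m * t (Suc m)"
    using Suc by (simp add: sum.distrib)
  finally show ?case by (simp add: algebra_simps)
qed simp

lemma sum_pairs_symmetric:
  fixes w :: "nat \<Rightarrow> nat \<Rightarrow> real"
  assumes "\<And>p q. w p q = w q p" "\<And>p. w p p = 0"
  shows "(\<Sum>p=1..m. \<Sum>q=1..m. w p q) = 2 * (\<Sum>p=1..m. \<Sum>q=p+1..m. w p q)"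
proof (induction m)
  case (Suc m)
  have "(\<Sum>p=1..Suc m. \<Sum>q=p+1..Suc m. w p q) = (\<Sum>p=1..m. (\<Sum>q=p+1..m. w p q) + w p (Suc m))"
    by simp
  moreover have "(\<Sum>p=1..m. w p (Suc m)) = (\<Sum>q=1..m. w (Suc m) q)"
    using assms by simp
  ultimately show ?case using Suc assms by (simp add: sum.distrib)
qed simp

lemma abs_combination_le:
  fixes c :: real
  assumes "\<bar>x1\<bar> \<le> c" "\<bar>x2\<bar> \<le> c" "\<bar>x3\<bar> \<le> c" "\<bar>y1\<bar> \<le> c" "\<bar>y2\<bar> \<le> c" "\<bar>y3\<bar> \<le> c"
  shows "\<bar>(x1 + x2 + 2 * x3) - (y1 + y2 + 2 * y3)\<bar> \<le> 8 * c"
  by (rule abs_leI) (use assms[THEN abs_le_D1] assms[THEN abs_le_D2] in linarith)+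

lemma sum_split_at:
  fixes h :: "nat \<Rightarrow> real"
  assumes "p \<le> m" "m \<le> n"
  shows "(\<Sum>q=p+1..n. h q) = (\<Sum>q=p+1..m. h q) + (\<Sum>q=m+1..n. h q)"
proof -
  have "{p+1..n} = {p+1..m} \<union> {m+1..n}" using assms by auto
  thus ?thesis by (simp add: sum.union_disjoint)
qed

lemma sum_Basis_prod:
  fixes h :: "'a::euclidean_space \<times> 'b::euclidean_space \<Rightarrow> 'c::comm_monoid_add"
  shows "(\<Sum>e\<in>Basis. h e) = (\<Sum>e\<in>Basis. h (e, 0)) + (\<Sum>e\<in>Basis. h (0, e))"
proof -
  have "inj_on (\<lambda>u. (u::'a, 0::'b)) Basis" "inj_on (\<lambda>u. (0::'a, u::'b)) Basis"
    by (auto intro!: inj_onI)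
  thus ?thesis
    unfolding Basis_prod_def by (subst sum.union_disjoint) (auto simp: sum.reindex)
qed

text \<open>An orthonormal basis of \<open>'a \<times> 'b\<close>, of which the first \<open>m = DIM('b)\<close> vectors are singled out. They span a
subspace that may be compared with the second factor: \<open>tilt\<close>, the sum of the squared sines of the
principal angles between the two, measures by how much they differ.\<close>

locale product_frame =
  fixes v :: "nat \<Rightarrow> 'a::euclidean_space \<times> 'b::euclidean_space" and m n :: nat
  assumes on: "\<And>i j. i \<in> {1..n} \<Longrightarrow> j \<in> {1..n} \<Longrightarrow> v i \<bullet> v j = (if i = j then 1 else 0)"
    and m: "m = DIM('b)" and n: "n = DIM('a) + DIM('b)"
begin

definition a where "a p = fst (v p)"
definition b where "b p = snd (v p)"

definition tilt :: real where "tilt = (\<Sum>p=1..m. a p \<bullet> a p)"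

lemma card_frame: "finite {1..n}" "card {1..n} = DIM('a \<times> 'b)"
  by (simp_all add: n)

lemma m_le_n: "m \<le> n" by (simp add: m n)

lemma unit: "a p \<bullet> a p + b p \<bullet> b p = 1" if "p \<in> {1..n}"
  using on[OF that that] by (simp add: a_def b_def inner_prod_def)

lemma trace_a: "(\<Sum>p=1..n. a p \<bullet> a p) = DIM('a)"
  and trace_b: "bilinear T \<Longrightarrow> (\<Sum>p=1..n. T (b p) (b p)) = (\<Sum>e\<in>Basis. T e e)"
    for T :: "'b \<Rightarrow> 'b \<Rightarrow> real"
proof -
  have "bilinear (\<lambda>x y :: 'a \<times> 'b. fst x \<bullet> fst y)"
    by (auto simp: bilinear_def inner_simps intro!: linearI)
  from trace_orthonormal[OF this on card_frame]
  show "(\<Sum>p=1..n. a p \<bullet> a p) = DIM('a)"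
    by (simp add: a_def sum_Basis_prod)
  show "(\<Sum>p=1..n. T (b p) (b p)) = (\<Sum>e\<in>Basis. T e e)" if T: "bilinear T" for T :: "'b \<Rightarrow> 'b \<Rightarrow> real"
  proof -
    have "bilinear (\<lambda>(x :: 'a \<times> 'b) (y :: 'a \<times> 'b). T (snd x) (snd y))"
      using T by (auto simp: bilinear_def linear_iff)
    from trace_orthonormal[OF this on card_frame] show ?thesis
      using bilinear_lzero[OF T]
      by (simp add: b_def sum_Basis_prod)
  qed
qed

lemma sum_frame_split: "(\<Sum>p=1..n. h p) = (\<Sum>p=1..m. h p) + (\<Sum>p=m+1..n. h p)" for h :: "nat \<Rightarrow> real"
  using sum_split_at[of 0 m n h] m_le_n by simp

text \<open>Both sides measure the missing part of the second factor: \<open>m\<close> unit vectors lose \<open>tilt\<close> of their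
length in \<open>'b\<close>, and the components in \<open>'b\<close> of the whole frame have total squared length \<open>m\<close>.\<close>

lemma tilt_complement: "(\<Sum>q=m+1..n. b q \<bullet> b q) = tilt"
proof -
  have "(\<Sum>p=1..m. a p \<bullet> a p + b p \<bullet> b p) = (\<Sum>p=1..m. 1)"
    by (rule sum.cong) (use m_le_n in \<open>auto intro!: unit\<close>)
  moreover have "bilinear (\<lambda>x y :: 'b. x \<bullet> y)"
    by (auto simp: bilinear_def inner_simps intro!: linearI)
  from trace_b[OF this] have "(\<Sum>p=1..n. b p \<bullet> b p) = real m" by (simp add: m)
  ultimately show ?thesis by (simp only: tilt_def sum_frame_split sum.distrib) simp
qed

lemma tilt_nonneg: "tilt \<ge> 0" by (simp add: tilt_def sum_nonneg)

lemma a_le_tilt: "a p \<bullet> a p \<le> tilt" if "p \<in> {1..m}"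
  unfolding tilt_def by (rule member_le_sum[OF that]) auto

lemma b_le_tilt: "b q \<bullet> b q \<le> tilt" if "q \<in> {m+1..n}"
  unfolding tilt_complement[symmetric]
  by (rule member_le_sum[OF that, of "\<lambda>q. b q \<bullet> b q"]) auto

text \<open>The summand \<open>w p q\<close> is symmetric, nonnegative and zero on the diagonal. Summed over all \<open>q\<close>, it gives
\<open>DIM('a) - 1\<close> times \<open>a p \<bullet> a p\<close> by Parseval. The pairs with \<open>p < q\<close> carry at least half of
the total over \<open>p \<le> m\<close>, since a pair is counted twice if \<open>q \<le> m\<close> and once otherwise.\<close>

lemma spherical_part:
  "(real DIM('a) - 1) / 2 * tilt
     \<le> (\<Sum>p=1..m. \<Sum>q=p+1..n. (a p \<bullet> a p) * (a q \<bullet> a q) - (a p \<bullet> a q)\<^sup>2)"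
proof -
  define w where "w p q = (a p \<bullet> a p) * (a q \<bullet> a q) - (a p \<bullet> a q)\<^sup>2" for p q
  have w0: "w p q \<ge> 0" for p q
    using Cauchy_Schwarz_ineq[of "a p" "a q"] by (simp add: w_def)
  have row: "(\<Sum>q=1..n. w p q) = (real DIM('a) - 1) * (a p \<bullet> a p)" for p
  proof -
    have "(\<Sum>q=1..n. (v q \<bullet> (a p, 0)) * (v q \<bullet> (a p, 0))) = (a p, 0 :: 'b) \<bullet> (a p, 0)"
      by (rule parseval[OF on card_frame])
    hence "(\<Sum>q=1..n. (a p \<bullet> a q)\<^sup>2) = a p \<bullet> a p"
      by (simp add: inner_prod_def a_def power2_eq_square inner_commute)
    thus ?thesis
      using trace_a by (simp only: w_def sum_subtractf flip: sum_distrib_left) (simp add: algebra_simps)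
  qed
  have rows: "(\<Sum>p=1..m. \<Sum>q=p+1..n. w p q)
      = (\<Sum>p=1..m. (\<Sum>q=p+1..m. w p q) + (\<Sum>q=m+1..n. w p q))"
    by (intro sum.cong refl sum_split_at) (use m_le_n in auto)
  have "(real DIM('a) - 1) * tilt = (\<Sum>p=1..m. \<Sum>q=1..n. w p q)"
    by (simp only: row tilt_def sum_distrib_left)
  also have "\<dots> = 2 * (\<Sum>p=1..m. \<Sum>q=p+1..m. w p q) + (\<Sum>p=1..m. \<Sum>q=m+1..n. w p q)"
    by (subst sum_frame_split) (subst sum.distrib, subst sum_pairs_symmetric,
         auto simp: w_def inner_commute power2_eq_square)
  also have "\<dots> \<le> 2 * ((\<Sum>p=1..m. \<Sum>q=p+1..m. w p q) + (\<Sum>p=1..m. \<Sum>q=m+1..n. w p q))"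
    by (simp add: sum_nonneg w0)
  also have "\<dots> = 2 * (\<Sum>p=1..m. \<Sum>q=p+1..n. w p q)"
    by (simp only: rows sum.distrib)
  finally show ?thesis by (simp add: w_def)
qed

text \<open>If the tilt is zero, the first \<open>m\<close> vectors are an orthonormal basis of \<open>'b\<close> and the others lie in \<open>'a\<close>. Then
the only nonzero terms are \<open>T (b p) (b p) + T (b q) (b q)\<close> for \<open>p < q \<le> m\<close> and \<open>H (b p) (b p)\<close> for \<open>p \<le> m < q\<close>, and
they add up to the traces. In general each term differs from this model \<open>M p q\<close> by at most \<open>8 * L * tilt\<close>. The
point is that the error is linear in the tilt, which is quadratic in the angles: everywhere
two factors of the size of an angle occur together. Products \<open>b p \<bullet> b q\<close> of components equal
\<open>- (a p \<bullet> a q)\<close> by orthogonality, and for \<open>q > m\<close> the vector \<open>b q\<close> itself is small.\<close>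

lemma base_part:
  fixes T H :: "'b \<Rightarrow> 'b \<Rightarrow> real"
  assumes T: "bilinear T" and H: "bilinear H"
    and T_le: "\<And>x y. \<bar>T x y\<bar> \<le> L * norm x * norm y"
    and H_le: "\<And>x y. \<bar>H x y\<bar> \<le> L * norm x * norm y"
    and L: "L \<ge> 0"
  shows "\<bar>(\<Sum>p=1..m. \<Sum>q=p+1..n. kulkarni_nomizu T (b p) (b q) (b p) (b q) + kulkarni_nomizu H (a p) (a q) (b p) (b q))
      - ((real m - 1) * (\<Sum>e\<in>Basis. T e e) + real DIM('a) * (\<Sum>e\<in>Basis. H e e))\<bar>
     \<le> 9 * (real n)\<^sup>2 * L * tilt"
proof -
  define t h where "t p = T (b p) (b p)" and "h p = H (b p) (b p)" for p
  define K where "K p q = kulkarni_nomizu T (b p) (b q) (b p) (b q) + kulkarni_nomizu H (a p) (a q) (b p) (b q)" for p q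
  define M where "M p q = (if q \<le> m then t p + t q else h p)" for p q
  have a1: "a p \<bullet> a p \<le> 1" and b1: "b p \<bullet> b p \<le> 1" if "p \<in> {1..n}" for p
    using unit[OF that] inner_ge_zero[of "a p"] inner_ge_zero[of "b p"] by linarith+
  have quad: "\<bar>B (b p) (b p)\<bar> \<le> L * (b p \<bullet> b p)" if "B = T \<or> B = H" for B p
    using that T_le[of "b p" "b p"] H_le[of "b p" "b p"]
    by (auto simp: power2_norm_eq_inner[symmetric] power2_eq_square mult.assoc)
  have quad1: "\<bar>B (b p) (b p) * (x \<bullet> x)\<bar> \<le> L * (x \<bullet> x)"
    if "B = T \<or> B = H" "p \<in> {1..n}" for B p and x :: "'z::real_inner"
  proof -
    have "\<bar>B (b p) (b p)\<bar> \<le> L * 1"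
      by (rule order_trans[OF quad[OF that(1)]]) (rule mult_left_mono[OF b1[OF that(2)] L])
    thus ?thesis by (simp add: abs_mult mult_right_mono)
  qed
  have n1: "norm (b p) \<le> 1" if "p \<in> {1..n}" for p
    using b1[OF that] by (simp add: norm_eq_sqrt_inner)
  have amgm: "r * s \<le> c" if "r * r \<le> c" "s * s \<le> c" for r s c :: real
    using that sum_squares_bound[of r s] by (simp add: power2_eq_square)
  have close: "\<bar>K p q - M p q\<bar> \<le> 8 * (L * tilt)" if p: "p \<in> {1..m}" and q: "q \<in> {p+1..n}" for p q
  proof -
    have pn: "p \<in> {1..n}" and qn: "q \<in> {1..n}" using p q m_le_n by auto
    have aq: "\<bar>a p \<bullet> a q\<bar> \<le> norm (a p) * norm (a q)" by (rule Cauchy_Schwarz_ineq2)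
    have ba: "a p \<bullet> a p = 1 - b p \<bullet> b p" "a q \<bullet> a q = 1 - b q \<bullet> b q"
      using unit[OF pn] unit[OF qn] by linarith+
    have bb: "b p \<bullet> b q = - (a p \<bullet> a q)"
      using on[OF pn qn] p q by (auto simp: inner_prod_def a_def b_def)
    have LS: "L * x \<le> L * tilt" if "x \<le> tilt" for x using that L by (rule mult_left_mono)
    \<comment> \<open>One factor of the size of an angle comes from \<open>a p\<close>, the other from \<open>a q\<close> or from \<open>b q\<close>.\<close>
    have cross: "\<bar>B (b p) (b q) * (a p \<bullet> a q)\<bar> \<le> L * tilt"
      if B: "B = T \<or> B = H" for B
    proof -
      have "\<bar>B (b p) (b q) * (a p \<bullet> a q)\<bar> \<le> (L * norm (b p) * norm (b q)) * (norm (a p) * norm (a q))"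
        unfolding abs_mult by (rule mult_mono) (use B T_le H_le aq L in auto)
      also have "\<dots> = L * ((norm (b p) * norm (b q)) * (norm (a p) * norm (a q)))" by simp
      also have "\<dots> \<le> L * tilt"
      proof (rule LS, cases "q \<le> m")
        case True
        have "norm (a p) * norm (a q) \<le> tilt"
          by (rule amgm) (use a_le_tilt[of p] a_le_tilt[of q] p q True in
              \<open>auto simp: power2_norm_eq_inner[symmetric] power2_eq_square\<close>)
        moreover have "norm (b p) * norm (b q) \<le> 1"
          using n1[OF pn] n1[OF qn] by (simp add: mult_le_one)
        ultimately show "(norm (b p) * norm (b q)) * (norm (a p) * norm (a q)) \<le> tilt"
          by (smt (verit) mult_left_le_one_le mult_nonneg_nonneg norm_ge_zero)
      next
        case False
        have "norm (a p) * norm (b q) \<le> tilt"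
          by (rule amgm) (use a_le_tilt[of p] b_le_tilt[of q] p q False in
              \<open>auto simp: power2_norm_eq_inner[symmetric] power2_eq_square\<close>)
        moreover have "norm (a q) \<le> 1"
          using a1[OF qn] by (simp add: norm_eq_sqrt_inner)
        hence "norm (b p) * norm (a q) \<le> 1"
          using n1[OF pn] by (simp add: mult_le_one)
        ultimately show "(norm (b p) * norm (b q)) * (norm (a p) * norm (a q)) \<le> tilt"
          by (smt (verit) mult.commute mult.left_commute mult_left_le_one_le mult_nonneg_nonneg norm_ge_zero)
      qed
      finally show ?thesis .
    qed
    note cT = cross[OF disjI1[OF refl]] and cH = cross[OF disjI2[OF refl]]
    note qT = quad1[OF disjI1[OF refl]] and qH = quad1[OF disjI2[OF refl]]
    have via: "\<bar>y\<bar> \<le> L * tilt" if "\<bar>y\<bar> \<le> L * x" "x \<le> tilt" for x y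
      using that LS[of x] by linarith
    note ap = a_le_tilt[OF p]
    show ?thesis
    proof (cases "q \<le> m")
      case True
      have aq: "a q \<bullet> a q \<le> tilt" using True p q by (intro a_le_tilt) auto
      have "K p q - M p q = (H (b p) (b p) * (a q \<bullet> a q) + H (b q) (b q) * (a p \<bullet> a p)
          + 2 * (T (b p) (b q) * (a p \<bullet> a q)))
          - (T (b p) (b p) * (a q \<bullet> a q) + T (b q) (b q) * (a p \<bullet> a p)
          + 2 * (H (b p) (b q) * (a p \<bullet> a q)))"
        using True by (simp add: K_def M_def kulkarni_nomizu_def bb t_def h_def ba algebra_simps)
      thus ?thesis
        using abs_combination_le[OF via[OF qH[OF pn] aq] via[OF qH[OF qn] ap] cT
            via[OF qT[OF pn] aq] via[OF qT[OF qn] ap] cH] by simp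
    next
      case False
      have bq: "b q \<bullet> b q \<le> tilt" using False p q by (intro b_le_tilt) auto
      have "K p q - M p q = (T (b p) (b p) * (b q \<bullet> b q) + T (b q) (b q) * (b p \<bullet> b p)
          + 2 * (T (b p) (b q) * (a p \<bullet> a q)))
          - (H (b p) (b p) * (b q \<bullet> b q) + - (H (b q) (b q) * (a p \<bullet> a p))
          + 2 * (H (b p) (b q) * (a p \<bullet> a q)))"
        using False by (simp add: K_def M_def kulkarni_nomizu_def bb t_def h_def ba algebra_simps)
      moreover have "\<bar>T (b q) (b q) * (b p \<bullet> b p)\<bar> \<le> L * (b q \<bullet> b q)"
        unfolding abs_mult using quad[of T q] b1[OF pn]
        by (smt (verit) abs_ge_zero inner_ge_zero mult_left_le)
      moreover have "\<bar>- (H (b q) (b q) * (a p \<bullet> a p))\<bar> \<le> L * (a p \<bullet> a p)"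
        unfolding abs_minus_cancel by (rule quad1) (use qn in auto)
      ultimately show ?thesis
        using abs_combination_le[OF via[OF qT[OF pn] bq] via[OF _ bq] cT
            via[OF qH[OF pn] bq] via[OF _ ap] cH] by metis
    qed
  qed
  have LS0: "L * tilt \<ge> 0" using L tilt_nonneg by simp
  have "\<bar>(\<Sum>p=1..m. \<Sum>q=p+1..n. K p q) - (\<Sum>p=1..m. \<Sum>q=p+1..n. M p q)\<bar>
      = \<bar>\<Sum>p=1..m. \<Sum>q=p+1..n. K p q - M p q\<bar>"
    by (simp add: sum_subtractf)
  also have "\<dots> \<le> (\<Sum>p=1..m. \<Sum>q=p+1..n. \<bar>K p q - M p q\<bar>)"
    by (rule order_trans[OF sum_abs]) (rule sum_mono, rule sum_abs)
  also have "\<dots> \<le> (\<Sum>p=1..m. \<Sum>q=p+1..n. 8 * (L * tilt))"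
    by (intro sum_mono close)
  also have "\<dots> \<le> (\<Sum>p=1..m. real n * (8 * (L * tilt)))"
    by (intro sum_mono) (use LS0 in \<open>simp add: mult_right_mono\<close>)
  also have "\<dots> \<le> real n * (real n * (8 * (L * tilt)))"
    using LS0 m_le_n by (simp add: mult_right_mono)
  also have "\<dots> = 8 * (real n)\<^sup>2 * (L * tilt)" by (simp add: power2_eq_square)
  finally have 1: "\<bar>(\<Sum>p=1..m. \<Sum>q=p+1..n. K p q) - (\<Sum>p=1..m. \<Sum>q=p+1..n. M p q)\<bar>
      \<le> 8 * (real n)\<^sup>2 * (L * tilt)" .
  have nm: "real (n - m) = real DIM('a)" by (simp add: m n)
  have "(\<Sum>p=1..m. \<Sum>q=p+1..n. M p q)
      = (\<Sum>p=1..m. (\<Sum>q=p+1..m. t p + t q) + real DIM('a) * h p)"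
  proof (rule sum.cong)
    fix p assume "p \<in> {1..m}"
    hence "(\<Sum>q=p+1..n. M p q) = (\<Sum>q=p+1..m. M p q) + (\<Sum>q=m+1..n. M p q)"
      using m_le_n by (intro sum_split_at) auto
    also have "(\<Sum>q=p+1..m. M p q) = (\<Sum>q=p+1..m. t p + t q)"
      by (rule sum.cong) (auto simp: M_def)
    also have "(\<Sum>q=m+1..n. M p q) = (\<Sum>q=m+1..n. h p)"
      by (rule sum.cong) (auto simp: M_def)
    finally show "(\<Sum>q=p+1..n. M p q) = (\<Sum>q=p+1..m. t p + t q) + real DIM('a) * h p"
      by (simp add: nm)
  qed simp
  also have "\<dots> = (real m - 1) * (\<Sum>p=1..m. t p) + real DIM('a) * (\<Sum>p=1..m. h p)"
    by (subst sum.distrib) (simp only: sum_pairs_additive sum_distrib_left)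
  finally have 2: "(\<Sum>p=1..m. \<Sum>q=p+1..n. M p q)
      = (real m - 1) * (\<Sum>p=1..m. t p) + real DIM('a) * (\<Sum>p=1..m. h p)" .
  have rest: "\<bar>\<Sum>q=m+1..n. B (b q) (b q)\<bar> \<le> L * tilt" if "B = T \<or> B = H" for B
    unfolding tilt_complement[symmetric] sum_distrib_left
    by (rule order_trans[OF sum_abs]) (rule sum_mono, rule quad[OF that])
  \<comment> \<open>The model sums run over the first vectors only; by the trace formula the rest is again small.\<close>
  have 3: "(\<Sum>p=1..m. t p) = (\<Sum>e\<in>Basis. T e e) - (\<Sum>q=m+1..n. t q)"
    "(\<Sum>p=1..m. h p) = (\<Sum>e\<in>Basis. H e e) - (\<Sum>q=m+1..n. h q)"
    using trace_b[OF T] trace_b[OF H] sum_frame_split by (simp_all add: t_def h_def)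
  have m1: "real m \<ge> 1" using m DIM_positive[where 'a='b] by linarith
  have 4: "\<bar>(real m - 1) * (\<Sum>q=m+1..n. t q)\<bar> \<le> (real m - 1) * (L * tilt)"
    unfolding abs_mult by (rule mult_mono) (use rest[of T] m1 in \<open>auto simp: t_def\<close>)
  have 5: "\<bar>real DIM('a) * (\<Sum>q=m+1..n. h q)\<bar> \<le> real DIM('a) * (L * tilt)"
    unfolding abs_mult by (rule mult_mono) (use rest[of H] in \<open>auto simp: h_def\<close>)
  have "(real m - 1) * (L * tilt) + real DIM('a) * (L * tilt) \<le> real n * (L * tilt)"
    using LS0 by (simp add: m n algebra_simps)
  also have "\<dots> \<le> (real n)\<^sup>2 * (L * tilt)"
    by (rule mult_right_mono[OF _ LS0]) (use m1 m_le_n in \<open>simp add: power2_eq_square\<close>)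
  finally have 6: "(real m - 1) * (L * tilt) + real DIM('a) * (L * tilt)
      \<le> (real n)\<^sup>2 * (L * tilt)" .
  have distr: "x * (y - y') + z * (w - w') = (x * y + z * w) - x * y' - z * w'"
    for x y y' z w w' :: real
    by (simp add: algebra_simps)
  have 7: "(\<Sum>p=1..m. \<Sum>q=p+1..n. M p q)
      = ((real m - 1) * (\<Sum>e\<in>Basis. T e e) + real DIM('a) * (\<Sum>e\<in>Basis. H e e))
        - (real m - 1) * (\<Sum>q=m+1..n. t q) - real DIM('a) * (\<Sum>q=m+1..n. h q)"
    unfolding 2 3 by (rule distr)
  have tri: "\<bar>x - r\<bar> \<le> c + d + e" if "\<bar>x - y\<bar> \<le> c" "y = r - p - q" "\<bar>p\<bar> \<le> d" "\<bar>q\<bar> \<le> e"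
    for x y r c d e p q :: real
    using that(1,3,4)[THEN abs_le_D1] that(1,3,4)[THEN abs_le_D2] that(2)
    by (intro abs_leI) linarith+
  have "8 * (real n)\<^sup>2 * (L * tilt) + (real m - 1) * (L * tilt) + real DIM('a) * (L * tilt)
      \<le> 8 * (real n)\<^sup>2 * (L * tilt) + (real n)\<^sup>2 * (L * tilt)"
    using 6 by (simp only: add.assoc add_left_mono)
  also have "\<dots> = 9 * (real n)\<^sup>2 * L * tilt" by (simp add: mult.assoc)
  finally show ?thesis
    using order_trans[OF tri[OF 1 7 4 5]] unfolding K_def by blast
qed

end

section \<open>Curvature of a conformally flat warped product\<close>

text \<open>The metric \<open>e\<^bsup>2(\<phi>(s) + f(x))\<^esup> |ds|\<^sup>2 + e\<^bsup>2b(x)\<^esup> |dx|\<^sup>2\<close> on a product of two Euclidean spaces: the warped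
product of a conformally flat fibre over a conformally flat base. The parameters named with \<open>g\<close> and \<open>H\<close>
are gradients and Hessians.\<close>

locale warped_conformal =
  fixes \<phi> :: "'a::euclidean_space \<Rightarrow> real" and g\<phi> :: "'a \<Rightarrow> 'a" and H\<phi> :: "'a \<Rightarrow> 'a \<Rightarrow> 'a"
    and f :: "'b::euclidean_space \<Rightarrow> real" and gf :: "'b \<Rightarrow> 'b" and Hf :: "'b \<Rightarrow> 'b \<Rightarrow> 'b"
    and b :: "'b \<Rightarrow> real" and gb :: "'b \<Rightarrow> 'b" and Hb :: "'b \<Rightarrow> 'b \<Rightarrow> 'b"
  assumes d\<phi>: "\<And>s. (\<phi> has_derivative (\<lambda>u. g\<phi> s \<bullet> u)) (at s)"
    and dg\<phi>: "\<And>s. (g\<phi> has_derivative H\<phi> s) (at s)"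
    and df: "\<And>x. (f has_derivative (\<lambda>u. gf x \<bullet> u)) (at x)"
    and dgf: "\<And>x. (gf has_derivative Hf x) (at x)"
    and db: "\<And>x. (b has_derivative (\<lambda>u. gb x \<bullet> u)) (at x)"
    and dgb: "\<And>x. (gb has_derivative Hb x) (at x)"
begin

definition \<alpha> :: "'a \<times> 'b \<Rightarrow> real" where "\<alpha> z = \<phi> (fst z) + f (snd z)"

definition metric :: "'a \<times> 'b \<Rightarrow> 'a \<times> 'b \<Rightarrow> 'a \<times> 'b \<Rightarrow> real" where
  "metric z u v = exp (2 * \<alpha> z) * (fst u \<bullet> fst v) + exp (2 * b (snd z)) * (snd u \<bullet> snd v)"

definition d\<alpha> :: "'a \<times> 'b \<Rightarrow> 'a \<times> 'b \<Rightarrow> real" where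
  "d\<alpha> z u = g\<phi> (fst z) \<bullet> fst u + gf (snd z) \<bullet> snd u"

definition d\<beta> :: "'a \<times> 'b \<Rightarrow> 'a \<times> 'b \<Rightarrow> real" where
  "d\<beta> z u = gb (snd z) \<bullet> snd u"

text \<open>The Levi-Civita connection of \<open>metric\<close>, found by solving the Koszul formula.\<close>

definition \<Gamma> :: "'a \<times> 'b \<Rightarrow> 'a \<times> 'b \<Rightarrow> 'a \<times> 'b \<Rightarrow> 'a \<times> 'b" where
  "\<Gamma> z u v =
    (d\<alpha> z u *\<^sub>R fst v + d\<alpha> z v *\<^sub>R fst u - (fst u \<bullet> fst v) *\<^sub>R g\<phi> (fst z),
     d\<beta> z u *\<^sub>R snd v + d\<beta> z v *\<^sub>R snd u
       - (exp (2 * \<alpha> z - 2 * b (snd z)) * (fst u \<bullet> fst v)) *\<^sub>R gf (snd z)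
       - (snd u \<bullet> snd v) *\<^sub>R gb (snd z))"

lemmas deriv_fst [derivative_intros] =
  has_derivative_compose[OF has_derivative_fst[OF has_derivative_ident] d\<phi>]
  has_derivative_compose[OF has_derivative_fst[OF has_derivative_ident] dg\<phi>]

lemmas deriv_snd [derivative_intros] =
  has_derivative_compose[OF has_derivative_snd[OF has_derivative_ident] df]
  has_derivative_compose[OF has_derivative_snd[OF has_derivative_ident] dgf]
  has_derivative_compose[OF has_derivative_snd[OF has_derivative_ident] db]
  has_derivative_compose[OF has_derivative_snd[OF has_derivative_ident] dgb]

lemma has_derivative_\<alpha> [derivative_intros]: "(\<alpha> has_derivative d\<alpha> z) (at z)"
  unfolding \<alpha>_def [abs_def] d\<alpha>_def [abs_def] by (auto intro!: derivative_eq_intros)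

lemma has_derivative_\<beta> [derivative_intros]: "((\<lambda>z. b (snd z)) has_derivative d\<beta> z) (at z)"
  unfolding d\<beta>_def [abs_def] by (auto intro!: derivative_eq_intros)

lemma frechet_metric:
  "frechet_derivative (\<lambda>z. metric z u v) (at z) w =
     2 * exp (2 * \<alpha> z) * d\<alpha> z w * (fst u \<bullet> fst v)
     + 2 * exp (2 * b (snd z)) * d\<beta> z w * (snd u \<bullet> snd v)"
proof -
  have "((\<lambda>z. metric z u v) has_derivative (\<lambda>w. 2 * exp (2 * \<alpha> z) * d\<alpha> z w * (fst u \<bullet> fst v)
     + 2 * exp (2 * b (snd z)) * d\<beta> z w * (snd u \<bullet> snd v))) (at z)"
    unfolding metric_def
    by (auto intro!: derivative_eq_intros has_derivative_\<alpha> has_derivative_\<beta> simp: algebra_simps)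
  from frechet_derivative_at[OF this, symmetric] show ?thesis by simp
qed

lemma metric_nondegenerate:
  assumes "\<And>w. metric z u w = metric z v w"
  shows "u = v"
proof -
  have "metric z (u - v) (u - v) = 0"
    using assms[of "u - v"] by (simp add: metric_def inner_diff_left algebra_simps)
  hence "fst (u - v) = 0 \<and> snd (u - v) = 0"
    unfolding metric_def
    by (subst (asm) add_nonneg_eq_0_iff) (auto simp: inner_eq_zero_iff)
  thus ?thesis by (simp add: prod_eq_iff)
qed

text \<open>Lowering an index removes the ratio of the two conformal factors: each block becomes the Koszul
formula of a conformal metric, where \<open>d\<alpha>\<close> includes the variation of the fibre along the base.\<close>

lemma metric_\<Gamma>:
  "metric z (\<Gamma> z u v) w =
     exp (2 * \<alpha> z) * (d\<alpha> z u * (fst v \<bullet> fst w) + d\<alpha> z v * (fst u \<bullet> fst w) - d\<alpha> z w * (fst u \<bullet> fst v))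
     + exp (2 * b (snd z)) *
         (d\<beta> z u * (snd v \<bullet> snd w) + d\<beta> z v * (snd u \<bullet> snd w) - d\<beta> z w * (snd u \<bullet> snd v))"
  by (simp add: metric_def \<Gamma>_def d\<alpha>_def d\<beta>_def inner_simps exp_diff field_simps)

lemma christoffel_metric: "christoffel metric z u v = \<Gamma> z u v"
proof -
  have *: "metric z (\<Gamma> z u v) w = (frechet_derivative (\<lambda>x. metric x v w) (at z) u
              + frechet_derivative (\<lambda>x. metric x u w) (at z) v
              - frechet_derivative (\<lambda>x. metric x u v) (at z) w) / 2" for w
    unfolding frechet_metric metric_\<Gamma> by (simp add: inner_commute field_simps)
  show ?thesis
    unfolding christoffel_def
  proof (rule the_equality, intro allI *)
    fix w
    assume w: "\<forall>x. metric z w x = (frechet_derivative (\<lambda>y. metric y v x) (at z) u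
              + frechet_derivative (\<lambda>y. metric y u x) (at z) v
              - frechet_derivative (\<lambda>y. metric y u v) (at z) x) / 2"
    show "w = \<Gamma> z u v"
      by (rule metric_nondegenerate[of z]) (simp only: * w[rule_format])
  qed
qed

lemma frechet_christoffel:
  "frechet_derivative (\<lambda>z. christoffel metric z v w) (at z) u =
    ((H\<phi> (fst z) (fst u) \<bullet> fst v + Hf (snd z) (snd u) \<bullet> snd v) *\<^sub>R fst w
       + (H\<phi> (fst z) (fst u) \<bullet> fst w + Hf (snd z) (snd u) \<bullet> snd w) *\<^sub>R fst v
       - (fst v \<bullet> fst w) *\<^sub>R H\<phi> (fst z) (fst u),
     (Hb (snd z) (snd u) \<bullet> snd v) *\<^sub>R snd w + (Hb (snd z) (snd u) \<bullet> snd w) *\<^sub>R snd v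
       - (exp (2 * \<alpha> z - 2 * b (snd z)) * (fst v \<bullet> fst w)) *\<^sub>R
           (Hf (snd z) (snd u) + (2 * (d\<alpha> z u - d\<beta> z u)) *\<^sub>R gf (snd z))
       - (snd v \<bullet> snd w) *\<^sub>R Hb (snd z) (snd u))"
    (is "_ = ?D u")
proof -
  let ?E = "\<lambda>z. exp (2 * \<alpha> z - 2 * b (snd z))"
  have E: "(?E has_derivative (\<lambda>u. ?E z * (2 * (d\<alpha> z u - d\<beta> z u)))) (at z)"
    by (auto intro!: derivative_eq_intros has_derivative_\<alpha> has_derivative_\<beta>)
  have a: "((\<lambda>z. d\<alpha> z v) has_derivative
      (\<lambda>u. H\<phi> (fst z) (fst u) \<bullet> fst v + Hf (snd z) (snd u) \<bullet> snd v)) (at z)" for v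
    unfolding d\<alpha>_def by (intro has_derivative_add has_derivative_inner_left deriv_fst deriv_snd)
  have b: "((\<lambda>z. d\<beta> z v) has_derivative (\<lambda>u. Hb (snd z) (snd u) \<bullet> snd v)) (at z)" for v
    unfolding d\<beta>_def by (intro has_derivative_inner_left deriv_snd)
  have "((\<lambda>z. \<Gamma> z v w) has_derivative
    (\<lambda>u. ((H\<phi> (fst z) (fst u) \<bullet> fst v + Hf (snd z) (snd u) \<bullet> snd v) *\<^sub>R fst w
       + (H\<phi> (fst z) (fst u) \<bullet> fst w + Hf (snd z) (snd u) \<bullet> snd w) *\<^sub>R fst v
       - (fst v \<bullet> fst w) *\<^sub>R H\<phi> (fst z) (fst u),
     (Hb (snd z) (snd u) \<bullet> snd v) *\<^sub>R snd w + (Hb (snd z) (snd u) \<bullet> snd w) *\<^sub>R snd v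
       - ((?E z * (fst v \<bullet> fst w)) *\<^sub>R Hf (snd z) (snd u)
         + (?E z * (2 * (d\<alpha> z u - d\<beta> z u)) * (fst v \<bullet> fst w)) *\<^sub>R gf (snd z))
       - (snd v \<bullet> snd w) *\<^sub>R Hb (snd z) (snd u)))) (at z)"
    unfolding \<Gamma>_def
    by (intro has_derivative_Pair has_derivative_add has_derivative_diff has_derivative_scaleR
          has_derivative_scaleR_left has_derivative_scaleR_right has_derivative_mult_left
          a b E deriv_fst deriv_snd)
  hence "((\<lambda>z. \<Gamma> z v w) has_derivative ?D) (at z)"
    by (rule has_derivative_eq_rhs) (simp add: fun_eq_iff algebra_simps)
  from frechet_derivative_at[OF this, symmetric] show ?thesis
    by (simp add: christoffel_metric)
qed

text \<open>After lowering the index, the four terms of the curvature operator become polynomials in the inner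
products of the gradients, Hessians and arguments, and the claim is an identity of polynomials. The
four summands are the curvature of the conformally flat fibre, that of the conformally
flat base, the mixed term with the Hessian of the warping function, and the term with its squared gradient.\<close>

lemma sectional:
  "curvature_tensor metric z u v v u =
     - exp (2 * \<alpha> z) * kulkarni_nomizu (schouten (H\<phi> (fst z)) (g\<phi> (fst z))) (fst u) (fst v) (fst u) (fst v)
     - exp (2 * b (snd z)) * kulkarni_nomizu (schouten (Hb (snd z)) (gb (snd z))) (snd u) (snd v) (snd u) (snd v)
     - exp (2 * \<alpha> z) * kulkarni_nomizu (warp_hess (Hf (snd z)) (gf (snd z)) (gb (snd z))) (fst u) (fst v) (snd u) (snd v)
     - exp (4 * \<alpha> z - 2 * b (snd z)) * (gf (snd z) \<bullet> gf (snd z)) *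
          ((fst u \<bullet> fst u) * (fst v \<bullet> fst v) - (fst u \<bullet> fst v)\<^sup>2)"
proof -
  \<comment> \<open>With \<open>E\<close> and \<open>B\<close> as the only exponentials, no denominators occur.\<close>
  define A B E where "A = exp (2 * \<alpha> z)" and "B = exp (2 * b (snd z))"
    and "E = exp (2 * \<alpha> z - 2 * b (snd z))"
  have A: "A = E * B" and E2: "exp (4 * \<alpha> z - 2 * b (snd z)) = E * E * B"
    by (simp_all add: A_def E_def B_def flip: exp_add)
  obtain u1 u2 v1 v2 where uv: "u = (u1, u2)" "v = (v1, v2)" by (metis surj_pair)
  define g h hb where "g = g\<phi> (fst z)" and "h = gf (snd z)" and "hb = gb (snd z)"
  define G F C where "G = H\<phi> (fst z)" and "F = Hf (snd z)" and "C = Hb (snd z)"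
  have \<Gamma>: "\<Gamma> z x y = ((g \<bullet> fst x + h \<bullet> snd x) *\<^sub>R fst y + (g \<bullet> fst y + h \<bullet> snd y) *\<^sub>R fst x - (fst x \<bullet> fst y) *\<^sub>R g,
     (hb \<bullet> snd x) *\<^sub>R snd y + (hb \<bullet> snd y) *\<^sub>R snd x - (E * (fst x \<bullet> fst y)) *\<^sub>R h - (snd x \<bullet> snd y) *\<^sub>R hb)"
    for x y
    by (simp add: \<Gamma>_def d\<alpha>_def d\<beta>_def g_def h_def hb_def E_def)
  have d\<Gamma>: "frechet_derivative (\<lambda>z. christoffel metric z x y) (at z) w =
    ((G (fst w) \<bullet> fst x + F (snd w) \<bullet> snd x) *\<^sub>R fst y
       + (G (fst w) \<bullet> fst y + F (snd w) \<bullet> snd y) *\<^sub>R fst x - (fst x \<bullet> fst y) *\<^sub>R G (fst w),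
     (C (snd w) \<bullet> snd x) *\<^sub>R snd y + (C (snd w) \<bullet> snd y) *\<^sub>R snd x
       - (E * (fst x \<bullet> fst y)) *\<^sub>R (F (snd w) + (2 * (g \<bullet> fst w + h \<bullet> snd w - hb \<bullet> snd w)) *\<^sub>R h)
       - (snd x \<bullet> snd y) *\<^sub>R C (snd w))" for x y w
    by (simp add: frechet_christoffel d\<alpha>_def d\<beta>_def g_def h_def hb_def E_def G_def F_def C_def)
  have M: "metric z x y = E * B * (fst x \<bullet> fst y) + B * (snd x \<bullet> snd y)" for x y
    by (simp add: metric_def A[unfolded A_def] B_def)
  have c: "fst u = u1" "snd u = u2" "fst v = v1" "snd v = v2" by (simp_all add: uv)
  let ?vv = "\<Gamma> z v v" and ?uv = "\<Gamma> z u v"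
  have N: "g \<bullet> fst ?vv = 2 * (g \<bullet> v1 + h \<bullet> v2) * (g \<bullet> v1) - (v1 \<bullet> v1) * (g \<bullet> g)"
     "h \<bullet> snd ?vv = 2 * (hb \<bullet> v2) * (h \<bullet> v2) - E * (v1 \<bullet> v1) * (h \<bullet> h) - (v2 \<bullet> v2) * (h \<bullet> hb)"
     "hb \<bullet> snd ?vv = 2 * (hb \<bullet> v2) * (hb \<bullet> v2) - E * (v1 \<bullet> v1) * (h \<bullet> hb) - (v2 \<bullet> v2) * (hb \<bullet> hb)"
    by (simp_all add: \<Gamma> c inner_simps inner_commute algebra_simps)
  have N': "g \<bullet> fst ?uv = (g \<bullet> u1 + h \<bullet> u2) * (g \<bullet> v1) + (g \<bullet> v1 + h \<bullet> v2) * (g \<bullet> u1) - (u1 \<bullet> v1) * (g \<bullet> g)"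
     "h \<bullet> snd ?uv = (hb \<bullet> u2) * (h \<bullet> v2) + (hb \<bullet> v2) * (h \<bullet> u2) - E * (u1 \<bullet> v1) * (h \<bullet> h) - (u2 \<bullet> v2) * (h \<bullet> hb)"
     "hb \<bullet> snd ?uv = 2 * (hb \<bullet> u2) * (hb \<bullet> v2) - E * (u1 \<bullet> v1) * (h \<bullet> hb) - (u2 \<bullet> v2) * (hb \<bullet> hb)"
     "v1 \<bullet> fst ?uv = (g \<bullet> u1 + h \<bullet> u2) * (v1 \<bullet> v1) + (g \<bullet> v1 + h \<bullet> v2) * (u1 \<bullet> v1) - (u1 \<bullet> v1) * (g \<bullet> v1)"
     "v2 \<bullet> snd ?uv = (hb \<bullet> u2) * (v2 \<bullet> v2) + (hb \<bullet> v2) * (u2 \<bullet> v2) - E * (u1 \<bullet> v1) * (h \<bullet> v2) - (u2 \<bullet> v2) * (hb \<bullet> v2)"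
     "fst ?uv \<bullet> u1 = (g \<bullet> u1 + h \<bullet> u2) * (u1 \<bullet> v1) + (g \<bullet> v1 + h \<bullet> v2) * (u1 \<bullet> u1) - (u1 \<bullet> v1) * (g \<bullet> u1)"
     "snd ?uv \<bullet> u2 = (hb \<bullet> u2) * (u2 \<bullet> v2) + (hb \<bullet> v2) * (u2 \<bullet> u2) - E * (u1 \<bullet> v1) * (h \<bullet> u2) - (u2 \<bullet> v2) * (hb \<bullet> u2)"
    by (simp_all add: \<Gamma> c inner_simps inner_commute algebra_simps)
  have metric_add: "metric z (x - y + y') w = metric z x w - metric z y w + metric z y' w" for x y y' w
    by (simp add: M inner_simps algebra_simps)
  have metric_diff: "metric z (x - y) w = metric z x w - metric z y w" for x y w
    by (simp add: M inner_simps algebra_simps)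
  have sym: "v1 \<bullet> u1 = u1 \<bullet> v1" "v2 \<bullet> u2 = u2 \<bullet> v2" by (simp_all add: inner_commute)
  have \<Gamma>1: "metric z (\<Gamma> z u ?vv) u = E * B * ((g \<bullet> fst ?vv + h \<bullet> snd ?vv) * (u1 \<bullet> u1))
      + B * (hb \<bullet> snd ?vv * (u2 \<bullet> u2))"
    unfolding metric_\<Gamma> A[unfolded A_def] B_def[symmetric] d\<alpha>_def d\<beta>_def
      g_def[symmetric] h_def[symmetric] hb_def[symmetric] c
    by (simp add: inner_commute algebra_simps)
  have \<Gamma>2: "metric z (\<Gamma> z v ?uv) u =
      E * B * ((g \<bullet> v1 + h \<bullet> v2) * (fst ?uv \<bullet> u1) + (g \<bullet> fst ?uv + h \<bullet> snd ?uv) * (u1 \<bullet> v1)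
          - (g \<bullet> u1 + h \<bullet> u2) * (v1 \<bullet> fst ?uv))
      + B * ((hb \<bullet> v2) * (snd ?uv \<bullet> u2) + (hb \<bullet> snd ?uv) * (u2 \<bullet> v2) - (hb \<bullet> u2) * (v2 \<bullet> snd ?uv))"
    unfolding metric_\<Gamma> A[unfolded A_def] B_def[symmetric] d\<alpha>_def d\<beta>_def
      g_def[symmetric] h_def[symmetric] hb_def[symmetric] c sym by simp
  have D1: "metric z (frechet_derivative (\<lambda>z. christoffel metric z v v) (at z) u) u =
      E * B * (2 * (G u1 \<bullet> v1 + F u2 \<bullet> v2) * (u1 \<bullet> v1) - (v1 \<bullet> v1) * (G u1 \<bullet> u1))
      + B * (2 * (C u2 \<bullet> v2) * (u2 \<bullet> v2)
         - E * (v1 \<bullet> v1) * (F u2 \<bullet> u2 + 2 * (g \<bullet> u1 + h \<bullet> u2 - hb \<bullet> u2) * (h \<bullet> u2))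
         - (v2 \<bullet> v2) * (C u2 \<bullet> u2))"
    by (simp only: d\<Gamma> M c fst_conv snd_conv inner_simps sym) (simp add: algebra_simps)
  have D2: "metric z (frechet_derivative (\<lambda>z. christoffel metric z u v) (at z) v) u =
      E * B * ((G v1 \<bullet> u1 + F v2 \<bullet> u2) * (u1 \<bullet> v1) + (G v1 \<bullet> v1 + F v2 \<bullet> v2) * (u1 \<bullet> u1) - (u1 \<bullet> v1) * (G v1 \<bullet> u1))
      + B * ((C v2 \<bullet> u2) * (u2 \<bullet> v2) + (C v2 \<bullet> v2) * (u2 \<bullet> u2)
         - E * (u1 \<bullet> v1) * (F v2 \<bullet> u2 + 2 * (g \<bullet> v1 + h \<bullet> v2 - hb \<bullet> v2) * (h \<bullet> u2))
         - (u2 \<bullet> v2) * (C v2 \<bullet> u2))"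
    by (simp only: d\<Gamma> M c fst_conv snd_conv inner_simps sym)
  show ?thesis
    unfolding curvature_tensor_def curvature_op_def christoffel_metric[of z]
      metric_diff[of "_ + _"] metric_add D1 D2 \<Gamma>1 \<Gamma>2 N N' A[unfolded A_def] B_def[symmetric] E2
      g_def[symmetric] h_def[symmetric] hb_def[symmetric]
      G_def[symmetric] F_def[symmetric] C_def[symmetric] c kulkarni_nomizu_def schouten_def warp_hess_def
    by (simp add: algebra_simps power2_eq_square)
qed
end

context warped_conformal
begin

text \<open>Rescaling identifies each tangent space isometrically with the Euclidean product, so that orthonormal
frames become orthonormal families in the sense of \<open>product_frame\<close>.\<close>

definition rescale :: "'a \<times> 'b \<Rightarrow> 'a \<times> 'b \<Rightarrow> 'a \<times> 'b" where
  "rescale z u = (exp (\<alpha> z) *\<^sub>R fst u, exp (b (snd z)) *\<^sub>R snd u)"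

lemma inner_rescale: "rescale z u \<bullet> rescale z v = metric z u v"
  by (simp add: rescale_def metric_def inner_prod_def exp_double power2_eq_square mult.assoc)

lemma linear_hessians: "linear (H\<phi> s)" "linear (Hf x)" "linear (Hb x)"
  using dg\<phi> dgf dgb by (blast intro: has_derivative_linear)+

lemma sectional_rescaled:
  defines "a u z \<equiv> fst (rescale z u)" and "t u z \<equiv> snd (rescale z u)"
  shows "curvature_tensor metric z u v v u =
     - exp (- 2 * \<alpha> z) * kulkarni_nomizu (schouten (H\<phi> (fst z)) (g\<phi> (fst z))) (a u z) (a v z) (a u z) (a v z)
     - exp (- 2 * b (snd z)) *
        (kulkarni_nomizu (schouten (Hb (snd z)) (gb (snd z))) (t u z) (t v z) (t u z) (t v z)
         + kulkarni_nomizu (warp_hess (Hf (snd z)) (gf (snd z)) (gb (snd z))) (a u z) (a v z) (t u z) (t v z)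
         + (gf (snd z) \<bullet> gf (snd z)) *
             ((a u z \<bullet> a u z) * (a v z \<bullet> a v z) - (a u z \<bullet> a v z)\<^sup>2))"
proof -
  define x y where "x = exp (\<alpha> z)" and "y = exp (b (snd z))"
  have nz: "x \<noteq> 0" "y \<noteq> 0" by (simp_all add: x_def y_def)
  have e: "exp (2 * \<alpha> z) = x\<^sup>2" "exp (2 * b (snd z)) = y\<^sup>2" "exp (- 2 * \<alpha> z) = 1 / x\<^sup>2"
    "exp (- 2 * b (snd z)) = 1 / y\<^sup>2" "exp (4 * \<alpha> z - 2 * b (snd z)) = x ^ 4 / y\<^sup>2"
    by (simp_all add: x_def y_def exp_diff exp_minus field_simps flip: exp_of_nat_mult exp_double)
  show ?thesis
    unfolding a_def t_def rescale_def fst_conv snd_conv x_def[symmetric] y_def[symmetric]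
      kulkarni_nomizu_scale[OF bilinear_schouten[OF linear_hessians(1)]]
      kulkarni_nomizu_scale[OF bilinear_schouten[OF linear_hessians(3)]]
      kulkarni_nomizu_scale[OF bilinear_warp_hess[OF linear_hessians(2)]] sectional e
    by (simp add: nz field_simps power2_eq_square power4_eq_xxxx)
qed

end

section \<open>Stereographic charts\<close>

definition conformal_factor :: "'a::real_inner \<Rightarrow> real" where
  "conformal_factor s = 2 / (1 + (norm s)\<^sup>2)"

lemma conformal_factor_pos: "conformal_factor s > 0"
  by (simp add: conformal_factor_def add_pos_nonneg)

lemma conformal_factor_norm: "conformal_factor s * (s \<bullet> s) = 2 - conformal_factor s"
proof -
  have "1 + (norm s)\<^sup>2 > 0" by (simp add: add_pos_nonneg)
  thus ?thesis by (simp add: conformal_factor_def power2_norm_eq_inner[symmetric] field_simps)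
qed

lemma has_derivative_conformal_factor:
  "(conformal_factor has_derivative (\<lambda>a. - ((conformal_factor s)\<^sup>2 * (s \<bullet> a)))) (at s)"
proof -
  have nz: "1 + s \<bullet> s > 0" by (simp add: add_pos_nonneg)
  have "((\<lambda>s. 2 / (1 + s \<bullet> s)) has_derivative (\<lambda>a. - ((2 / (1 + s \<bullet> s))\<^sup>2 * (s \<bullet> a)))) (at s)"
    by (rule has_derivative_eq_rhs, (rule derivative_intros)+)
       (use nz in \<open>auto simp: fun_eq_iff field_simps power2_eq_square inner_commute\<close>)
  thus ?thesis by (simp add: conformal_factor_def[abs_def] power2_norm_eq_inner)
qed

lemma stereo_conformal_factor: "stereo \<sigma> s = (conformal_factor s *\<^sub>R s, \<sigma> * (1 - conformal_factor s))"
proof -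
  have "1 + (norm s)\<^sup>2 > 0" by (simp add: add_pos_nonneg)
  thus ?thesis by (simp add: stereo_def conformal_factor_def field_simps)
qed

definition dstereo :: "real \<Rightarrow> real^'k::finite \<Rightarrow> real^'k \<Rightarrow> (real^'k) \<times> real" where
  "dstereo \<sigma> s a = (conformal_factor s *\<^sub>R a - ((conformal_factor s)\<^sup>2 * (s \<bullet> a)) *\<^sub>R s, \<sigma> * ((conformal_factor s)\<^sup>2 * (s \<bullet> a)))"

lemma has_derivative_stereo: "(stereo \<sigma> has_derivative dstereo \<sigma> s) (at s)"
  unfolding stereo_conformal_factor[abs_def] dstereo_def[abs_def]
  by (rule has_derivative_eq_rhs, (rule derivative_intros has_derivative_conformal_factor)+)
     (auto simp: fun_eq_iff)

lemma dchart_dstereo: "dchart \<sigma> z a = (dstereo \<sigma> (fst z) (fst a), snd a)"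
  unfolding dchart_def
  by (simp add: frechet_derivative_at[OF has_derivative_stereo, symmetric])

lemma conformal_factor_sq: "(conformal_factor s)\<^sup>2 * (s \<bullet> s) = 2 * conformal_factor s - (conformal_factor s)\<^sup>2"
proof -
  have "(conformal_factor s)\<^sup>2 * (s \<bullet> s) = conformal_factor s * (conformal_factor s * (s \<bullet> s))" by (simp add: power2_eq_square)
  thus ?thesis by (simp only: conformal_factor_norm) (simp add: power2_eq_square algebra_simps)
qed

lemma dstereo_conformal:
  assumes "\<sigma>\<^sup>2 = 1"
  shows "dstereo \<sigma> s a \<bullet> dstereo \<sigma> s b = (conformal_factor s)\<^sup>2 * (a \<bullet> b)"
proof -
  have "dstereo \<sigma> s a \<bullet> dstereo \<sigma> s b
     = (conformal_factor s)\<^sup>2 * (a \<bullet> b) + (conformal_factor s)\<^sup>2 * (s \<bullet> a) * (s \<bullet> b) *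
       ((conformal_factor s)\<^sup>2 * (s \<bullet> s) - 2 * conformal_factor s + \<sigma>\<^sup>2 * (conformal_factor s)\<^sup>2)"
    by (simp add: dstereo_def inner_prod_def inner_simps inner_commute power2_eq_square algebra_simps)
  thus ?thesis by (simp add: assms conformal_factor_sq)
qed

lemma dstereo_tangent:
  assumes "\<sigma>\<^sup>2 = 1"
  shows "dstereo \<sigma> s a \<bullet> stereo \<sigma> s = 0"
proof -
  have "dstereo \<sigma> s a \<bullet> stereo \<sigma> s
     = conformal_factor s * (s \<bullet> a) * (conformal_factor s - (conformal_factor s)\<^sup>2 * (s \<bullet> s) + \<sigma>\<^sup>2 * (1 - conformal_factor s) * conformal_factor s)"
    by (simp add: dstereo_def stereo_conformal_factor inner_prod_def inner_simps inner_commute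
        power2_eq_square algebra_simps)
  thus ?thesis by (simp add: assms conformal_factor_sq) (simp add: power2_eq_square algebra_simps)
qed

text \<open>The derivative is injective because it is conformal, and it maps into the tangent space, which has the
same dimension.\<close>

lemma range_dstereo:
  assumes "\<sigma>\<^sup>2 = 1"
  shows "range (dstereo \<sigma> s) = {X. X \<bullet> stereo \<sigma> s = 0}"
proof -
  have lin: "linear (dstereo \<sigma> s)"
    using has_derivative_stereo[of \<sigma> s] by (rule has_derivative_linear)
  have inj: "inj (dstereo \<sigma> s)"
  proof (rule linear_injective_0[OF lin, THEN iffD2], intro allI impI)
    fix a assume "dstereo \<sigma> s a = 0"
    hence "(conformal_factor s)\<^sup>2 * (a \<bullet> a) = 0"
      using dstereo_conformal[OF assms, of s a a] by simp
    thus "a = 0" using conformal_factor_pos[of s] by simp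
  qed
  have "stereo \<sigma> s \<noteq> 0"
  proof
    assume 0: "stereo \<sigma> s = 0"
    hence "conformal_factor s *\<^sub>R s = 0" "\<sigma> * (1 - conformal_factor s) = 0" by (simp_all add: stereo_conformal_factor zero_prod_def)
    with assms conformal_factor_pos[of s] have "s = 0" "conformal_factor s = 1" by auto
    thus False by (simp add: conformal_factor_def)
  qed
  hence "dim {X. X \<bullet> stereo \<sigma> s = 0} = CARD('a)"
    using dim_hyperplane[of "stereo \<sigma> s"] by (simp add: inner_commute)
  moreover have "dim (range (dstereo \<sigma> s)) = CARD('a)"
    using dim_image_eq[OF lin, of UNIV] inj by (simp add: dim_UNIV)
  moreover have "subspace {X. X \<bullet> stereo \<sigma> s = 0}"
    using subspace_hyperplane[of "stereo \<sigma> s"] by (simp add: inner_commute)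
  ultimately show ?thesis
    using linear_subspace_image[OF lin subspace_UNIV] dstereo_tangent[OF assms]
    by (intro subspace_dim_equal) auto
qed

text \<open>Projecting from the pole in the opposite hemisphere keeps the denominator \<open>1 - \<sigma> * t\<close> positive.\<close>

lemma stereo_surj:
  assumes "y \<in> sphere 0 1"
  obtains \<sigma> s where "\<sigma> \<in> {1, -1}" "stereo \<sigma> s = y"
proof -
  obtain x t where y: "y = (x, t)" by (cases y)
  have eq: "x \<bullet> x + t * t = 1"
    using assms by (simp add: y norm_Pair power2_norm_eq_inner power2_eq_square[of t])
  define \<sigma> :: real where "\<sigma> = (if t \<le> 0 then 1 else -1)"
  have \<sigma>: "\<sigma> * \<sigma> = 1" "1 - \<sigma> * t > 0" by (auto simp: \<sigma>_def)
  define s where "s = (1 / (1 - \<sigma> * t)) *\<^sub>R x"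
  have "x \<bullet> x = (1 - \<sigma> * t) * (1 + \<sigma> * t)"
    using eq \<sigma>(1) by (auto simp: \<sigma>_def algebra_simps)
  hence "s \<bullet> s = (1 + \<sigma> * t) / (1 - \<sigma> * t)"
    using \<sigma> by (simp add: s_def power2_eq_square divide_simps)
  hence "2 = (1 - \<sigma> * t) * (1 + s \<bullet> s)"
    using \<sigma>(2) by (simp add: field_simps)
  moreover have "1 + s \<bullet> s > 0" by (simp add: add_pos_nonneg)
  ultimately have "conformal_factor s = 1 - \<sigma> * t"
    unfolding conformal_factor_def power2_norm_eq_inner by (subst divide_eq_eq) simp
  hence "stereo \<sigma> s = y" using \<sigma> by (simp add: stereo_conformal_factor y s_def)
  moreover have "\<sigma> \<in> {1, -1}" by (simp add: \<sigma>_def)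
  ultimately show ?thesis using that by blast
qed

lemma chart_surj:
  assumes "p \<in> sphere_torus"
  obtains \<sigma> z where "\<sigma> \<in> {1, -1}" "chart \<sigma> z = p"
proof -
  obtain y q where p: "p = (y, q)" "y \<in> sphere 0 1" "q \<in> torus"
    using assms by (auto simp: sphere_torus_def)
  obtain \<sigma> s where "\<sigma> \<in> {1, -1}" "stereo \<sigma> s = y" using stereo_surj[OF p(2)] .
  moreover obtain x where "q = torus_pt x"
    using p(3) by (auto simp: torus_def torus_pt_def elim: quotientE)
  ultimately show ?thesis using that[of \<sigma> "(s, x)"] by (simp add: chart_def p)
qed

text \<open>The differential is not surjective onto the ambient vectors, so its inverse is meaningful on tangent vectors
only.\<close>

lemma dchart_inv:
  assumes "\<sigma>\<^sup>2 = 1" "X \<in> tangent_space (chart \<sigma> z)"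
  shows "dchart \<sigma> z (inv (dchart \<sigma> z) X) = X"
proof -
  have "fst X \<in> range (dstereo \<sigma> (fst z))"
    using assms by (simp add: range_dstereo tangent_space_def chart_def)
  then obtain a where "fst X = dstereo \<sigma> (fst z) a" by auto
  hence "X = dchart \<sigma> z (a, snd X)" by (simp add: dchart_dstereo prod_eq_iff)
  hence "X \<in> range (dchart \<sigma> z)" by (rule range_eqI)
  thus ?thesis by (rule f_inv_into_f)
qed

lemma warped_metric_chart:
  assumes "\<sigma>\<^sup>2 = 1"
  shows "warped_metric n m \<epsilon> F (chart \<sigma> z) (dchart \<sigma> z a) (dchart \<sigma> z b) =
    (\<epsilon> * F (torus_pt (snd z)) * conformal_factor (fst z))\<^sup>2 * (fst a \<bullet> fst b)
    + F (torus_pt (snd z)) powr (-2 * ((real n - real m) / (real m - 1))) * (snd a \<bullet> snd b)"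
  by (simp add: warped_metric_def chart_def dchart_dstereo dstereo_conformal[OF assms] inner_vec_def
        power_mult_distrib)

lemma has_derivative_ln_conformal_factor:
  "((\<lambda>s. c + ln (conformal_factor s)) has_derivative (\<lambda>u. (- conformal_factor s *\<^sub>R s) \<bullet> u)) (at s)"
  by (rule has_derivative_eq_rhs, (rule has_derivative_conformal_factor conformal_factor_pos derivative_intros)+)
     (use conformal_factor_pos[of s] in \<open>auto simp: fun_eq_iff power2_eq_square field_simps\<close>)

lemma has_derivative_grad_ln_conformal_factor:
  "((\<lambda>s. - conformal_factor s *\<^sub>R s) has_derivative (\<lambda>u. ((conformal_factor s)\<^sup>2 * (s \<bullet> u)) *\<^sub>R s - conformal_factor s *\<^sub>R u)) (at s)"
  by (rule has_derivative_eq_rhs, (rule derivative_intros has_derivative_conformal_factor)+)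
     (auto simp: fun_eq_iff)

text \<open>Half the metric, up to sign: this expresses that the round sphere has constant curvature one.\<close>

lemma schouten_conformal_factor:
  "schouten (\<lambda>u. ((conformal_factor s)\<^sup>2 * (s \<bullet> u)) *\<^sub>R s - conformal_factor s *\<^sub>R u) (- conformal_factor s *\<^sub>R s) u v
     = - (conformal_factor s)\<^sup>2 / 2 * (u \<bullet> v)"
proof -
  have "schouten (\<lambda>u. ((conformal_factor s)\<^sup>2 * (s \<bullet> u)) *\<^sub>R s - conformal_factor s *\<^sub>R u) (- conformal_factor s *\<^sub>R s) u v
     = ((conformal_factor s)\<^sup>2 * (s \<bullet> s) - 2 * conformal_factor s) / 2 * (u \<bullet> v)"
    by (simp add: schouten_def inner_simps power2_eq_square algebra_simps)
  thus ?thesis by (simp add: conformal_factor_sq)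
qed

section \<open>Functions on the torus\<close>

lemma torus_pt_eq: "torus_pt x = torus_pt y \<longleftrightarrow> (\<forall>i. x $ i - y $ i \<in> \<int>)"
proof
  assume "torus_pt x = torus_pt y"
  hence "(y, y) \<in> torus_rel \<Longrightarrow> (x, y) \<in> torus_rel" by (auto simp: torus_pt_def)
  thus "\<forall>i. x $ i - y $ i \<in> \<int>" by (simp add: torus_rel_def)
next
  assume xy: "\<forall>i. x $ i - y $ i \<in> \<int>"
  have "x $ i - z $ i \<in> \<int> \<longleftrightarrow> y $ i - z $ i \<in> \<int>" for z i
  proof
    assume "x $ i - z $ i \<in> \<int>"
    from Ints_diff[OF this xy[rule_format, of i]] show "y $ i - z $ i \<in> \<int>" by simp
  next
    assume "y $ i - z $ i \<in> \<int>"
    from Ints_add[OF this xy[rule_format, of i]] show "x $ i - z $ i \<in> \<int>" by simp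
  qed
  thus "torus_pt x = torus_pt y" by (auto simp: torus_pt_def torus_rel_def)
qed

lemma torus_pt_in [simp]: "torus_pt x \<in> torus"
  by (simp add: torus_pt_def torus_def quotientI)

lemma torusE:
  assumes "q \<in> torus" obtains x where "q = torus_pt x"
  using assms by (auto simp: torus_def torus_pt_def elim: quotientE)

text \<open>The representative chosen in the definition of the partial derivative differs from \<open>x\<close> by an integer
vector, and translation by it leaves the lift unchanged.\<close>

lemma torus_partial_lift:
  "torus_partial i f (torus_pt x) = frechet_derivative (\<lambda>x. f (torus_pt x)) (at x) (axis i 1)"
proof -
  define y where "y = (SOME y. y \<in> torus_pt x)"
  have "x \<in> torus_pt x" by (simp add: torus_pt_def torus_rel_def)
  hence "y \<in> torus_pt x" unfolding y_def by (rule someI)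
  hence xy: "x $ i - y $ i \<in> \<int>" for i by (simp add: torus_pt_def torus_rel_def)
  let ?f = "\<lambda>x. f (torus_pt x)"
  have transl: "(?f has_derivative D) (at z)"
    if D: "(?f has_derivative D) (at w)" and c: "\<And>i. w $ i - z $ i \<in> \<int>" for D w z
  proof -
    have "torus_pt (t + (w - z)) = torus_pt t" for t
      using c by (simp add: torus_pt_eq)
    hence f: "?f t = ?f (t + (w - z))" for t by simp
    have "((\<lambda>t. t + (w - z)) has_derivative (\<lambda>t. t)) (at z)"
      by (auto intro!: derivative_eq_intros)
    from has_derivative_compose[OF this, of ?f D] D show ?thesis
      by (subst f) simp
  qed
  have "y $ i - x $ i \<in> \<int>" for i using Ints_minus[OF xy[of i]] by simp
  hence "(?f has_derivative D) (at x) \<longleftrightarrow> (?f has_derivative D) (at y)" for D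
    using transl xy by blast
  thus ?thesis by (simp add: torus_partial_def y_def frechet_derivative_def)
qed

text \<open>Reducing every coordinate to its fractional part moves each point into the compact unit cube. Boundedness
is what makes the suprema in \<open>C2_norm\<close> genuine bounds.\<close>

lemma torus_bounded:
  fixes f :: "(real^'m::finite) set \<Rightarrow> real"
  assumes "continuous_on UNIV (\<lambda>x. f (torus_pt x))"
  shows "bdd_above ((\<lambda>q. \<bar>f q\<bar>) ` torus)"
proof -
  let ?C = "cbox 0 (\<chi> i. 1) :: (real^'m) set"
  have "compact ((\<lambda>x. \<bar>f (torus_pt x)\<bar>) ` ?C)"
    by (intro compact_continuous_image continuous_on_rabs) (auto intro: continuous_on_subset[OF assms])
  hence bdd: "bdd_above ((\<lambda>x. \<bar>f (torus_pt x)\<bar>) ` ?C)"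
    by (intro bounded_imp_bdd_above compact_imp_bounded)
  have "(\<lambda>q. \<bar>f q\<bar>) ` torus \<subseteq> (\<lambda>x. \<bar>f (torus_pt x)\<bar>) ` ?C"
  proof clarify
    fix q :: "(real^'m) set" assume "q \<in> torus"
    then obtain x where q: "q = torus_pt x" by (rule torusE)
    define y where "y = (\<chi> i. frac (x $ i))"
    have "torus_pt x = torus_pt y"
      by (auto simp: torus_pt_eq y_def frac_def)
    moreover have "y \<in> ?C"
      by (auto simp: y_def mem_box_cart less_imp_le[OF frac_lt_1])
    ultimately show "\<bar>f q\<bar> \<in> (\<lambda>x. \<bar>f (torus_pt x)\<bar>) ` ?C" using q by auto
  qed
  thus ?thesis by (rule bdd_above_mono[OF bdd])
qed

definition torus_grad :: "((real^'m::finite) set \<Rightarrow> real) \<Rightarrow> real^'m \<Rightarrow> real^'m" where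
  "torus_grad f x = (\<chi> i. torus_partial i f (torus_pt x))"

definition torus_hess :: "((real^'m::finite) set \<Rightarrow> real) \<Rightarrow> real^'m \<Rightarrow> real^'m \<Rightarrow> real^'m" where
  "torus_hess f x u = (\<chi> j. \<Sum>i\<in>UNIV. u $ i * torus_partial i (torus_partial j f) (torus_pt x))"

lemma has_derivative_partials:
  assumes "(\<lambda>x. f (torus_pt x)) differentiable (at x)"
  shows "((\<lambda>x. f (torus_pt x)) has_derivative (\<lambda>u. \<Sum>i\<in>UNIV. u $ i * torus_partial i f (torus_pt x)))
    (at x)"
proof -
  let ?D = "frechet_derivative (\<lambda>x. f (torus_pt x)) (at x)"
  have D: "((\<lambda>x. f (torus_pt x)) has_derivative ?D) (at x)"
    using assms by (simp add: frechet_derivative_works)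
  hence lin: "linear ?D" by (rule has_derivative_linear)
  have "?D u = (\<Sum>i\<in>UNIV. u $ i * torus_partial i f (torus_pt x))" for u
  proof -
    have "?D u = ?D (\<Sum>i\<in>UNIV. u $ i *\<^sub>R axis i 1)"
      using basis_expansion[of u] by (simp add: scalar_mult_eq_scaleR)
    thus ?thesis
      by (simp add: linear_sum[OF lin] linear_cmul[OF lin] torus_partial_lift)
  qed
  thus ?thesis by (intro has_derivative_eq_rhs[OF D]) (rule ext)
qed

locale torus_C2 =
  fixes f :: "(real^'m::finite) set \<Rightarrow> real"
  assumes C2: "cont_diff (Suc (Suc 0)) (\<lambda>x. f (torus_pt x))"
begin

lemma diff0: "(\<lambda>x. f (torus_pt x)) differentiable (at x)"
  and diff1: "(\<lambda>x. torus_partial i f (torus_pt x)) differentiable (at x)"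
  and cont2: "continuous_on UNIV (\<lambda>x. torus_partial j (torus_partial i f) (torus_pt x))"
  using C2 by (simp_all add: torus_partial_lift[abs_def] axis_in_Basis_iff)

lemma has_derivative_lift: "((\<lambda>x. f (torus_pt x)) has_derivative (\<lambda>u. torus_grad f x \<bullet> u)) (at x)"
  using has_derivative_partials[OF diff0]
  by (simp add: torus_grad_def inner_vec_def mult.commute)

lemma has_derivative_grad: "(torus_grad f has_derivative torus_hess f x) (at x)"
  unfolding has_derivative_componentwise_within[where f = "torus_grad f"]
  using has_derivative_partials[OF diff1]
  by (auto simp: Basis_vec_def inner_axis torus_grad_def torus_hess_def)

lemma continuous_lift:
  "continuous_on UNIV (\<lambda>x. f (torus_pt x))"
  "continuous_on UNIV (\<lambda>x. torus_partial i f (torus_pt x))"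
  by (auto intro!: differentiable_imp_continuous_on simp: differentiable_on_def diff0 diff1)

lemma C2_bounds:
  "\<bar>f (torus_pt x)\<bar> \<le> C2_norm f" (is ?A)
  "norm (torus_grad f x) \<le> C2_norm f" (is ?B)
  "\<bar>torus_hess f x u \<bullet> v\<bar> \<le> C2_norm f * norm u * norm v" (is ?C)
proof -
  have le: "\<bar>h (torus_pt x)\<bar> \<le> (SUP q\<in>torus. \<bar>h q\<bar>)" if "continuous_on UNIV (\<lambda>x. h (torus_pt x))"
    for h :: "(real^'m) set \<Rightarrow> real"
    by (rule cSUP_upper[OF torus_pt_in torus_bounded[OF that]])
  define P0 P1 P2 where "P0 = (SUP q\<in>torus. \<bar>f q\<bar>)"
    and "P1 = (\<Sum>i\<in>UNIV. SUP q\<in>torus. \<bar>torus_partial i f q\<bar>)"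
    and "P2 = (\<Sum>i\<in>UNIV. \<Sum>j\<in>UNIV. SUP q\<in>torus. \<bar>torus_partial i (torus_partial j f) q\<bar>)"
  have N: "C2_norm f = P0 + P1 + P2" by (simp add: C2_norm_def P0_def P1_def P2_def)
  have 0: "\<bar>f (torus_pt x)\<bar> \<le> P0" unfolding P0_def by (rule le continuous_lift)+
  have 1: "(\<Sum>i\<in>UNIV. \<bar>torus_partial i f (torus_pt x)\<bar>) \<le> P1"
    unfolding P1_def by (intro sum_mono le continuous_lift)
  have 2: "(\<Sum>i\<in>UNIV. \<Sum>j\<in>UNIV. \<bar>torus_partial i (torus_partial j f) (torus_pt x)\<bar>) \<le> P2"
    unfolding P2_def by (intro sum_mono le cont2)
  have nn: "P0 \<ge> 0" "P1 \<ge> 0" "P2 \<ge> 0"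
    by (rule order_trans[OF _ 0] order_trans[OF _ 1] order_trans[OF _ 2]; simp add: sum_nonneg)+
  show ?A using 0 nn N by linarith
  have "norm (torus_grad f x) \<le> (\<Sum>i\<in>UNIV. \<bar>torus_grad f x $ i\<bar>)" by (rule norm_le_l1_cart)
  thus ?B using 1 nn N by (simp add: torus_grad_def)
  have "\<bar>torus_hess f x u \<bullet> v\<bar>
      = \<bar>\<Sum>j\<in>UNIV. \<Sum>i\<in>UNIV. u $ i * v $ j * torus_partial i (torus_partial j f) (torus_pt x)\<bar>"
    by (simp add: torus_hess_def inner_vec_def sum_distrib_left mult_ac)
  also have "\<dots> \<le> (\<Sum>j\<in>UNIV. \<Sum>i\<in>UNIV. \<bar>u $ i * v $ j * torus_partial i (torus_partial j f) (torus_pt x)\<bar>)"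
    by (rule order_trans[OF sum_abs]) (rule sum_mono, rule sum_abs)
  also have "\<dots> \<le> (\<Sum>j\<in>UNIV. \<Sum>i\<in>UNIV. norm u * norm v * \<bar>torus_partial i (torus_partial j f) (torus_pt x)\<bar>)"
    unfolding abs_mult
    by (intro sum_mono mult_right_mono mult_mono component_le_norm_cart) auto
  also have "\<dots> = norm u * norm v *
      (\<Sum>i\<in>UNIV. \<Sum>j\<in>UNIV. \<bar>torus_partial i (torus_partial j f) (torus_pt x)\<bar>)"
    by (subst sum.swap) (simp add: sum_distrib_left)
  also have "\<dots> \<le> norm u * norm v * C2_norm f"
    using 2 nn N by (intro mult_left_mono) auto
  finally show ?C by (simp add: mult_ac)
qed

end

lemma torus_ln:
  assumes F: "torus_smooth F" and pos: "\<And>q. q \<in> torus \<Longrightarrow> F q > 0"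
  shows "torus_C2 (\<lambda>q. ln (F q))"
    and "q \<in> torus \<Longrightarrow> torus_partial i (\<lambda>q. ln (F q)) q = torus_partial i F q / F q"
proof -
  have "torus_C2 F"
    using F unfolding torus_C2_def torus_smooth_def smooth_def by blast
  then interpret F: torus_C2 F .
  let ?\<Phi> = "\<lambda>x. F (torus_pt x)"
  let ?D = "\<lambda>f x. frechet_derivative f (at x)"
  have pos': "?\<Phi> x > 0" for x by (simp add: pos)
  have dF: "(?\<Phi> has_derivative ?D ?\<Phi> x) (at x)" for x
    using F.diff0 by (simp add: frechet_derivative_works)
  have dln: "((\<lambda>x. ln (?\<Phi> x)) has_derivative (\<lambda>u. ?D ?\<Phi> x u / ?\<Phi> x)) (at x)" for x
    by (rule has_derivative_eq_rhs, rule has_derivative_ln[OF pos' dF])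
       (simp add: fun_eq_iff field_simps)
  have Dln: "?D (\<lambda>x. ln (?\<Phi> x)) x u = ?D ?\<Phi> x u / ?\<Phi> x" for x u
    by (simp add: frechet_derivative_at[OF dln, symmetric])
  have d2: "((\<lambda>x. ?D ?\<Phi> x b / ?\<Phi> x) has_derivative
      (\<lambda>u. ?D (\<lambda>x. ?D ?\<Phi> x b) x u / ?\<Phi> x - ?D ?\<Phi> x b * ?D ?\<Phi> x u / (?\<Phi> x)\<^sup>2)) (at x)"
    if "b \<in> Basis" for b x
  proof -
    have "((\<lambda>x. ?D ?\<Phi> x b) has_derivative ?D (\<lambda>x. ?D ?\<Phi> x b) x) (at x)"
      using F.C2 that by (simp add: frechet_derivative_works)
    from has_derivative_divide'[OF this dF] pos'[of x] show ?thesis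
      by (rule_tac has_derivative_eq_rhs) (auto simp: fun_eq_iff field_simps power2_eq_square)
  qed
  have c0: "continuous_on UNIV ?\<Phi>" by (rule F.continuous_lift)
  have c1: "continuous_on UNIV (\<lambda>x. ?D ?\<Phi> x b)" if "b \<in> Basis" for b
    using F.C2 that by (intro differentiable_imp_continuous_on) (simp add: differentiable_on_def)
  have c2: "continuous_on UNIV (\<lambda>x. ?D (\<lambda>x. ?D ?\<Phi> x b) x c)" if "b \<in> Basis" "c \<in> Basis" for b c
    using F.C2 that by simp
  show "torus_C2 (\<lambda>q. ln (F q))"
  proof (unfold_locales, unfold cont_diff.simps, intro conjI ballI allI)
    show "(\<lambda>x. ln (?\<Phi> x)) differentiable (at x)" for x
      using dln by (rule differentiableI)
    fix b :: "real^'a" assume b: "b \<in> Basis"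
    show "(\<lambda>x. ?D (\<lambda>x. ln (?\<Phi> x)) x b) differentiable (at x)" for x
      unfolding Dln using d2[OF b] by (rule differentiableI)
    fix c :: "real^'a" assume c: "c \<in> Basis"
    show "continuous_on UNIV (\<lambda>x. ?D (\<lambda>x. ?D (\<lambda>x. ln (?\<Phi> x)) x b) x c)"
      unfolding Dln frechet_derivative_at[OF d2[OF b], symmetric]
      by (intro continuous_intros c0 c1 c2 b c) (use pos' in \<open>auto simp: less_imp_neq[symmetric]\<close>)
  qed
  show "torus_partial i (\<lambda>q. ln (F q)) q = torus_partial i F q / F q" if q: "q \<in> torus"
  proof -
    obtain x where "q = torus_pt x" using torusE[OF q] .
    thus ?thesis by (simp add: torus_partial_lift Dln)
  qed
qed

section \<open>Intermediate curvature of the warped metric\<close>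

text \<open>Everything is expressed through \<open>f = ln F\<close>, called \<open>lnF\<close>, whose \<open>C\<^sup>2\<close> norm governs the estimates. It
enters the conformal exponent of the sphere as \<open>f\<close> and that of the torus as \<open>- c * f\<close>.\<close>

locale warped_torus =
  fixes F :: "(real^'m::finite) set \<Rightarrow> real" and \<epsilon> :: real and n m :: nat
  assumes smooth_F: "torus_smooth F" and F_pos: "\<And>q. q \<in> torus \<Longrightarrow> F q > 0"
    and \<epsilon>_pos: "\<epsilon> > 0" and m2: "m \<ge> 2" and mn: "m \<le> n" and dim_torus: "CARD('m) = m"
begin

definition lnF where "lnF q = ln (F q)"

definition c :: real where "c = (real n - real m) / (real m - 1)"

sublocale C2: torus_C2 lnF
  unfolding lnF_def[abs_def] by (rule torus_ln[OF smooth_F F_pos])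

lemma c_nonneg: "c \<ge> 0" using m2 mn by (simp add: c_def)

sublocale wc: warped_conformal
  "\<lambda>s :: real^'k::finite. ln \<epsilon> + ln (conformal_factor s)" "\<lambda>s. - conformal_factor s *\<^sub>R s"
  "\<lambda>s u. ((conformal_factor s)\<^sup>2 * (s \<bullet> u)) *\<^sub>R s - conformal_factor s *\<^sub>R u"
  "\<lambda>x. lnF (torus_pt x)" "torus_grad lnF" "torus_hess lnF"
  "\<lambda>x. - c * lnF (torus_pt x)" "\<lambda>x. - c *\<^sub>R torus_grad lnF x" "\<lambda>x u. - c *\<^sub>R torus_hess lnF x u"
proof (unfold_locales)
  show "((\<lambda>x. - c * lnF (torus_pt x)) has_derivative (\<lambda>u. (- c *\<^sub>R torus_grad lnF x) \<bullet> u)) (at x)" for x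
    using has_derivative_mult_right[OF C2.has_derivative_lift, of "- c"] by simp
  show "((\<lambda>x. - c *\<^sub>R torus_grad lnF x) has_derivative (\<lambda>u. - c *\<^sub>R torus_hess lnF x u)) (at x)" for x
    by (rule has_derivative_scaleR_right[OF C2.has_derivative_grad])
qed (rule has_derivative_ln_conformal_factor has_derivative_grad_ln_conformal_factor C2.has_derivative_lift C2.has_derivative_grad)+

lemma metric_in_chart:
  assumes "\<sigma>\<^sup>2 = 1"
  shows "warped_metric n m \<epsilon> F (chart \<sigma> z) (dchart \<sigma> z a) (dchart \<sigma> z b) = wc.metric z a b"
proof -
  let ?F = "F (torus_pt (snd z))"
  have F: "?F > 0" by (simp add: F_pos)
  have "exp (wc.\<alpha> z) = \<epsilon> * ?F * conformal_factor (fst z)"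
    unfolding wc.\<alpha>_def by (simp add: lnF_def exp_add F \<epsilon>_pos conformal_factor_pos)
  hence "exp (2 * wc.\<alpha> z) = (\<epsilon> * ?F * conformal_factor (fst z))\<^sup>2"
    by (simp add: exp_double)
  moreover have "exp (2 * (- c * lnF (torus_pt (snd z)))) = ?F powr (- 2 * ((real n - real m) / (real m - 1)))"
    using F unfolding c_def[symmetric] by (simp add: powr_def lnF_def)
  ultimately show ?thesis
    by (simp only: warped_metric_chart[OF assms] wc.metric_def)
qed

text \<open>A common bound for the two forms below. The coefficients are generous; only the dependence on the
\<open>C\<^sup>2\<close> norm of \<open>ln F\<close>, uniformly over the torus, matters.\<close>

definition form_bound :: real where
  "form_bound = (1 + c)\<^sup>2 * (C2_norm lnF + 3 * (C2_norm lnF)\<^sup>2)"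

definition base_form where
  "base_form x = schouten (\<lambda>u. - c *\<^sub>R torus_hess lnF x u) (- c *\<^sub>R torus_grad lnF x)"

definition mixed_form where
  "mixed_form x = warp_hess (torus_hess lnF x) (torus_grad lnF x) (- c *\<^sub>R torus_grad lnF x)"

lemma linear_hess: "linear (torus_hess lnF x)"
  using C2.has_derivative_grad by (rule has_derivative_linear)

lemma bilinear_forms: "bilinear (base_form x)" "bilinear (mixed_form x)"
proof -
  have "linear (\<lambda>u. - c *\<^sub>R torus_hess lnF x u)"
    using linear_hess[of x] by (auto simp: linear_iff algebra_simps)
  thus "bilinear (base_form x)" unfolding base_form_def by (rule bilinear_schouten)
  show "bilinear (mixed_form x)" unfolding mixed_form_def by (rule bilinear_warp_hess[OF linear_hess])
qed

lemma C2_norm_nonneg: "C2_norm lnF \<ge> 0"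
  using C2.C2_bounds(1) abs_ge_zero order_trans by blast

lemma form_bounds:
  "\<bar>base_form x u v\<bar> \<le> form_bound * norm u * norm v"
  "\<bar>mixed_form x u v\<bar> \<le> form_bound * norm u * norm v"
proof -
  define K where "K = C2_norm lnF"
  define P where "P = norm u * norm v"
  define h gu gv gg uv where "h = torus_hess lnF x u \<bullet> v"
    and "gu = torus_grad lnF x \<bullet> u" and "gv = torus_grad lnF x \<bullet> v"
    and "gg = torus_grad lnF x \<bullet> torus_grad lnF x" and "uv = u \<bullet> v"
  have K: "K \<ge> 0" using C2_norm_nonneg by (simp add: K_def)
  have P: "P \<ge> 0" by (simp add: P_def)
  have g: "norm (torus_grad lnF x) \<le> K" unfolding K_def by (rule C2.C2_bounds)
  have h: "\<bar>h\<bar> \<le> K * P" using C2.C2_bounds(3)[of x u v] by (simp add: h_def K_def P_def mult.assoc)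
  have gw: "\<bar>torus_grad lnF x \<bullet> w\<bar> \<le> K * norm w" for w
    by (rule order_trans[OF Cauchy_Schwarz_ineq2 mult_right_mono[OF g]]) simp
  have guv: "\<bar>gu * gv\<bar> \<le> K\<^sup>2 * P"
    using mult_mono[OF gw[of u] gw[of v]] K
    by (simp add: abs_mult gu_def gv_def P_def power2_eq_square mult_ac)
  have "gg \<le> K\<^sup>2"
    using power_mono[OF g, of 2] by (simp add: gg_def power2_norm_eq_inner)
  moreover have "gg \<ge> 0" by (simp add: gg_def)
  ultimately have guw: "\<bar>gg * uv\<bar> \<le> K\<^sup>2 * P"
    unfolding abs_mult by (intro mult_mono) (auto simp: uv_def P_def Cauchy_Schwarz_ineq2)
  have KP: "0 \<le> K * P" "0 \<le> K\<^sup>2 * P" using K P by simp_all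
  have c0: "c \<ge> 0" by (rule c_nonneg)
  have L: "form_bound * norm u * norm v = (1 + c)\<^sup>2 * (K * P) + 3 * (1 + c)\<^sup>2 * (K\<^sup>2 * P)"
    by (simp add: form_bound_def K_def P_def algebra_simps)
  have "base_form x u v = - c * h - c\<^sup>2 * (gu * gv) + c\<^sup>2 / 2 * (gg * uv)"
    by (simp add: base_form_def schouten_def h_def gu_def gv_def gg_def uv_def power2_eq_square)
  also have "\<bar>\<dots>\<bar> \<le> c * (K * P) + c\<^sup>2 * (K\<^sup>2 * P) + c\<^sup>2 / 2 * (K\<^sup>2 * P)"
    using mult_left_mono[OF h c0] mult_left_mono[OF guv, of "c\<^sup>2"] mult_left_mono[OF guw, of "c\<^sup>2 / 2"] c0
    by (intro order_trans[OF abs_triangle_ineq] order_trans[OF abs_triangle_ineq4] add_mono)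
       (auto simp: abs_mult)
  also have "\<dots> \<le> (1 + c)\<^sup>2 * (K * P) + 3 * (1 + c)\<^sup>2 * (K\<^sup>2 * P)"
  proof -
    have "c * (K * P) \<le> (1 + c)\<^sup>2 * (K * P)"
      by (rule mult_right_mono[OF _ KP(1)]) (use c0 in \<open>simp add: power2_eq_square algebra_simps\<close>)
    moreover have "(c\<^sup>2 + c\<^sup>2 / 2) * (K\<^sup>2 * P) \<le> 3 * (1 + c)\<^sup>2 * (K\<^sup>2 * P)"
      by (rule mult_right_mono[OF _ KP(2)]) (use c0 in \<open>simp add: power2_eq_square algebra_simps\<close>)
    ultimately show ?thesis by (simp add: algebra_simps)
  qed
  finally show "\<bar>base_form x u v\<bar> \<le> form_bound * norm u * norm v" by (simp add: L)
  have "mixed_form x u v = h + (1 + 2 * c) * (gu * gv) - c * (gg * uv)"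
    by (simp add: mixed_form_def warp_hess_def h_def gu_def gv_def gg_def uv_def algebra_simps)
  also have "\<bar>\<dots>\<bar> \<le> K * P + (1 + 2 * c) * (K\<^sup>2 * P) + c * (K\<^sup>2 * P)"
    using h mult_left_mono[OF guv, of "1 + 2 * c"] mult_left_mono[OF guw c0] c0
    by (intro order_trans[OF abs_triangle_ineq4] order_trans[OF abs_triangle_ineq] add_mono)
       (auto simp: abs_mult)
  also have "\<dots> \<le> (1 + c)\<^sup>2 * (K * P) + 3 * (1 + c)\<^sup>2 * (K\<^sup>2 * P)"
  proof -
    have "1 * (K * P) \<le> (1 + c)\<^sup>2 * (K * P)"
      by (rule mult_right_mono[OF _ KP(1)]) (use c0 in \<open>simp add: power2_eq_square algebra_simps\<close>)
    moreover have "((1 + 2 * c) + c) * (K\<^sup>2 * P) \<le> 3 * (1 + c)\<^sup>2 * (K\<^sup>2 * P)"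
      by (rule mult_right_mono[OF _ KP(2)]) (use c0 in \<open>simp add: power2_eq_square algebra_simps\<close>)
    ultimately show ?thesis by (simp add: algebra_simps)
  qed
  finally show "\<bar>mixed_form x u v\<bar> \<le> form_bound * norm u * norm v" by (simp add: L)
qed

text \<open>Here the exponent \<open>c\<close> of the metric is used: the Laplacian of \<open>ln F\<close> enters the first trace with factor
\<open>- c\<close> and the second with factor one, and \<open>(m - 1) * c = n - m\<close> makes it cancel. Only the squared gradient remains.\<close>

lemma trace_forms:
  "(real m - 1) * (\<Sum>e\<in>Basis. base_form x e e) + (real n - real m) * (\<Sum>e\<in>Basis. mixed_form x e e)
     = - ((real n - real m) * ((real n - real m) * (real m - 2) / (2 * (real m - 1)) - 1)
          * (torus_grad lnF x \<bullet> torus_grad lnF x))"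
proof -
  let ?g = "torus_grad lnF x"
  define G where "G = ?g \<bullet> ?g"
  define \<Delta> where "\<Delta> = (\<Sum>e\<in>Basis. torus_hess lnF x e \<bullet> e)"
  have G: "(\<Sum>e\<in>Basis. (?g \<bullet> e) * (?g \<bullet> e)) = G"
    by (simp add: G_def euclidean_inner[of ?g ?g])
  have dim: "(\<Sum>e\<in>(Basis :: (real^'m) set). e \<bullet> e) = real m"
    by (simp add: dim_torus flip: norm_eq_1)
  have 1: "(\<Sum>e\<in>Basis. base_form x e e) = - c * \<Delta> - c\<^sup>2 * G + c\<^sup>2 * G / 2 * real m"
  proof -
    have "(\<Sum>e\<in>Basis. base_form x e e) =
        (\<Sum>e\<in>Basis. - c * (torus_hess lnF x e \<bullet> e) - c\<^sup>2 * ((?g \<bullet> e) * (?g \<bullet> e)) + c\<^sup>2 * G / 2 * (e \<bullet> e))"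
      by (simp add: base_form_def schouten_def G_def power2_eq_square mult_ac)
    thus ?thesis
      by (simp only: sum.distrib sum_subtractf G dim \<Delta>_def flip: sum_distrib_left)
  qed
  have 2: "(\<Sum>e\<in>Basis. mixed_form x e e) = \<Delta> + (1 + 2 * c) * G - c * G * real m"
  proof -
    have "(\<Sum>e\<in>Basis. mixed_form x e e) =
        (\<Sum>e\<in>Basis. torus_hess lnF x e \<bullet> e + (1 + 2 * c) * ((?g \<bullet> e) * (?g \<bullet> e)) - c * G * (e \<bullet> e))"
      by (simp add: mixed_form_def warp_hess_def G_def algebra_simps)
    thus ?thesis
      by (simp only: sum.distrib sum_subtractf G dim \<Delta>_def flip: sum_distrib_left)
  qed
  define M where "M = real m - 1"
  have M: "M \<noteq> 0" using m2 by (simp add: M_def)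
  have k: "real n - real m = c * M" using M by (simp add: c_def M_def)
  have m: "real m = M + 1" by (simp add: M_def)
  show ?thesis
    unfolding 1 2 k G_def[symmetric] M_def[symmetric] unfolding m
    using M by (simp add: field_simps power2_eq_square)
qed

text \<open>The inverse of the conformal factor of the torus: it converts squared Euclidean norms of covectors into metric ones.\<close>

definition stretch :: "real^'m \<Rightarrow> real" where "stretch x = exp (2 * c * lnF (torus_pt x))"

text \<open>The curvature of a plane tangent to the sphere factor: \<open>1 / (\<epsilon> F)\<^sup>2\<close>, the intrinsic one, minus the
correction for the gradient of the warping function. Only through this quantity does \<open>\<epsilon>\<close> enter the curvature.\<close>

definition sphere_curv :: "real^'m \<Rightarrow> real" where
  "sphere_curv x = exp (- 2 * lnF (torus_pt x)) / \<epsilon>\<^sup>2 - stretch x * (torus_grad lnF x \<bullet> torus_grad lnF x)"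

lemma sectional_chart:
  fixes z :: "(real^'k::finite) \<times> (real^'m)"
  defines "a u \<equiv> fst (wc.rescale z u)" and "t u \<equiv> snd (wc.rescale z u)"
  shows "curvature_tensor wc.metric z u v v u =
     sphere_curv (snd z) * ((a u \<bullet> a u) * (a v \<bullet> a v) - (a u \<bullet> a v)\<^sup>2)
     - stretch (snd z) * (kulkarni_nomizu (base_form (snd z)) (t u) (t v) (t u) (t v)
                        + kulkarni_nomizu (mixed_form (snd z)) (a u) (a v) (t u) (t v))"
proof -
  have \<alpha>: "exp (- 2 * wc.\<alpha> z) = exp (- 2 * lnF (torus_pt (snd z))) / (\<epsilon>\<^sup>2 * (conformal_factor (fst z))\<^sup>2)"
  proof -
    have neg: "exp (- 2 * y) = 1 / (exp y)\<^sup>2" for y :: real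
      by (simp add: exp_minus exp_double divide_inverse)
    have "exp (wc.\<alpha> z) = \<epsilon> * conformal_factor (fst z) * exp (lnF (torus_pt (snd z)))"
      unfolding wc.\<alpha>_def by (simp add: exp_add \<epsilon>_pos conformal_factor_pos)
    thus ?thesis by (simp only: neg) (simp add: power_mult_distrib)
  qed
  have kulkarni_nomizu: "kulkarni_nomizu (schouten (\<lambda>u. ((conformal_factor s)\<^sup>2 * (s \<bullet> u)) *\<^sub>R s - conformal_factor s *\<^sub>R u) (- conformal_factor s *\<^sub>R s)) x y x y
      = - (conformal_factor s)\<^sup>2 * ((x \<bullet> x) * (y \<bullet> y) - (x \<bullet> y)\<^sup>2)" for s x y :: "real^'k"
    unfolding kulkarni_nomizu_def schouten_conformal_factor by (simp add: power2_eq_square algebra_simps)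
  have st: "exp (- 2 * (- c * lnF (torus_pt (snd z)))) = stretch (snd z)"
    by (simp add: stretch_def)
  have cancel: "- (x / (\<epsilon>\<^sup>2 * (conformal_factor (fst z))\<^sup>2)) * (- (conformal_factor (fst z))\<^sup>2 * y) = x / \<epsilon>\<^sup>2 * y" for x y :: real
    using conformal_factor_pos[of "fst z"] by simp
  show ?thesis
    unfolding wc.sectional_rescaled kulkarni_nomizu \<alpha> st a_def[symmetric] t_def[symmetric]
      base_form_def[symmetric] mixed_form_def[symmetric] sphere_curv_def cancel
    by (simp add: algebra_simps)
qed

text \<open>Since the metric has the same form in all charts, it does not matter which one is selected by the choice operator.\<close>

lemma riemann_chart:
  fixes p :: "('k::finite, 'm) point"
  assumes "p \<in> sphere_torus"
  obtains \<sigma> z where "\<sigma>\<^sup>2 = 1" "chart \<sigma> z = p"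
    "\<And>X Y. riemann (warped_metric n m \<epsilon> F) p X Y Y X =
       curvature_tensor wc.metric z (inv (dchart \<sigma> z) X) (inv (dchart \<sigma> z) Y)
         (inv (dchart \<sigma> z) Y) (inv (dchart \<sigma> z) X)"
proof -
  obtain \<sigma> z where sz: "(SOME (\<sigma>, z). \<sigma> \<in> {1, -1} \<and> chart \<sigma> z = p) = (\<sigma>, z)"
    by (meson surj_pair)
  obtain \<sigma>' z' where "\<sigma>' \<in> {1, -1}" "chart \<sigma>' z' = p"
    using chart_surj[OF assms] .
  hence "case (SOME (\<sigma>, z). \<sigma> \<in> {1, -1} \<and> chart \<sigma> z = p) of (\<sigma>, z) \<Rightarrow> \<sigma> \<in> {1, -1} \<and> chart \<sigma> z = p"
    by (intro someI[of "\<lambda>(\<sigma>, z). \<sigma> \<in> {1, -1} \<and> chart \<sigma> z = p" "(\<sigma>', z')"]) simp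
  hence "\<sigma> \<in> {1, -1}" and p: "chart \<sigma> z = p" unfolding sz by simp_all
  hence \<sigma>: "\<sigma>\<^sup>2 = 1" by auto
  have G: "(\<lambda>z a b. warped_metric n m \<epsilon> F (chart \<sigma> z) (dchart \<sigma> z a) (dchart \<sigma> z b)) = wc.metric"
    by (intro ext metric_in_chart[OF \<sigma>])
  have riem: "riemann (warped_metric n m \<epsilon> F) p X Y Y X =
       curvature_tensor wc.metric z (inv (dchart \<sigma> z) X) (inv (dchart \<sigma> z) Y)
         (inv (dchart \<sigma> z) Y) (inv (dchart \<sigma> z) X)" for X Y
    unfolding riemann_def sz Let_def prod.case G ..
  show ?thesis by (rule that[OF \<sigma> p riem])
qed

text \<open>The constant in the curvature formula. By \<open>trace_forms\<close> it is what the traces leave over.\<close>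

definition torus_const :: real where
  "torus_const = (real n - real m) * ((real n - real m) * (real m - 2) / (2 * (real m - 1)) - 1)"

text \<open>The heart of the proof. Here \<open>S\<close> is the tilt of the frame and \<open>W\<close> the sum of the Gram determinants of its
spherical components. Up to an error of order \<open>S\<close> that does not involve \<open>\<epsilon>\<close>, the intermediate curvature is its
value at the tangent space of the torus plus \<open>sphere_curv x * W\<close>, and \<open>W\<close> is itself at least of order \<open>S\<close>.\<close>

lemma intermediate_curvature_estimate:
  fixes p :: "('k::finite, 'm) point"
  assumes dim: "CARD('k) = n - m" and p: "p \<in> sphere_torus"
    and frame: "orthonormal_frame (warped_metric n m \<epsilon> F) p n e"
  obtains x S W where "snd p = torus_pt x" "S \<ge> 0" "W \<ge> (real n - real m - 1) / 2 * S"
    "(\<And>i. i \<in> {1..m} \<Longrightarrow> fst (e i) = 0) \<Longrightarrow> S = 0 \<and> W = 0"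
    "\<bar>intermediate_curvature (warped_metric n m \<epsilon> F) p n m e
        - (sphere_curv x * W + stretch x * torus_const * (torus_grad lnF x \<bullet> torus_grad lnF x))\<bar>
      \<le> stretch x * (9 * (real n)\<^sup>2 * form_bound * S)"
proof -
  obtain \<sigma> z where \<sigma>: "\<sigma>\<^sup>2 = 1" and pz: "chart \<sigma> z = p"
    and riem: "\<And>X Y. riemann (warped_metric n m \<epsilon> F) p X Y Y X =
       curvature_tensor wc.metric z (inv (dchart \<sigma> z) X) (inv (dchart \<sigma> z) Y)
         (inv (dchart \<sigma> z) Y) (inv (dchart \<sigma> z) X)"
    using riemann_chart[OF p] by blast
  define u where "u i = inv (dchart \<sigma> z) (e i)" for i
  define v where "v i = wc.rescale z (u i)" for i
  define x where "x = snd z"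
  have du: "dchart \<sigma> z (u i) = e i" if "i \<in> {1..n}" for i
    unfolding u_def using frame that
    by (intro dchart_inv[OF \<sigma>]) (auto simp: pz orthonormal_frame_def)
  interpret product_frame v m n
  proof
    fix i j assume ij: "i \<in> {1..n}" "j \<in> {1..n}"
    have "v i \<bullet> v j = warped_metric n m \<epsilon> F p (e i) (e j)"
      unfolding v_def wc.inner_rescale metric_in_chart[OF \<sigma>, symmetric] du[OF ij(1)] du[OF ij(2)] pz ..
    thus "v i \<bullet> v j = (if i = j then 1 else 0)"
      using frame ij by (simp add: orthonormal_frame_def)
  qed (use dim dim_torus mn in simp_all)
  define w where "w i j = (a i \<bullet> a i) * (a j \<bullet> a j) - (a i \<bullet> a j)\<^sup>2" for i j
  define K where "K i j = kulkarni_nomizu (base_form x) (b i) (b j) (b i) (b j)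
    + kulkarni_nomizu (mixed_form x) (a i) (a j) (b i) (b j)" for i j
  define W B where "W = (\<Sum>i=1..m. \<Sum>j=i+1..n. w i j)" and "B = (\<Sum>i=1..m. \<Sum>j=i+1..n. K i j)"
  have k: "real CARD('k) = real n - real m" using dim mn by simp
  have "riemann (warped_metric n m \<epsilon> F) p (e i) (e j) (e j) (e i) =
      sphere_curv x * w i j - stretch x * K i j" for i j
    unfolding riem sectional_chart w_def K_def a_def b_def v_def u_def x_def ..
  hence C: "intermediate_curvature (warped_metric n m \<epsilon> F) p n m e = sphere_curv x * W - stretch x * B"
    by (simp only: intermediate_curvature_def W_def B_def sum_subtractf sum_distrib_left)
  have sx: "stretch x \<ge> 0" by (simp add: stretch_def)
  have bd0: "form_bound \<ge> 0" using C2_norm_nonneg by (simp add: form_bound_def)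
  have "\<bar>B - ((real m - 1) * (\<Sum>e\<in>Basis. base_form x e e)
      + real CARD('k) * (\<Sum>e\<in>Basis. mixed_form x e e))\<bar> \<le> 9 * (real n)\<^sup>2 * form_bound * tilt"
    using base_part[OF bilinear_forms[of x] form_bounds[of x] bd0]
    unfolding B_def K_def by (simp only: DIM_cart DIM_real mult_1_right)
  hence "\<bar>B + torus_const * (torus_grad lnF x \<bullet> torus_grad lnF x)\<bar> \<le> 9 * (real n)\<^sup>2 * form_bound * tilt"
    unfolding k trace_forms torus_const_def by simp
  from mult_left_mono[OF this sx] sx
  have est: "\<bar>stretch x * (B + torus_const * (torus_grad lnF x \<bullet> torus_grad lnF x))\<bar>
      \<le> stretch x * (9 * (real n)\<^sup>2 * form_bound * tilt)"
    by (simp add: abs_mult)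
  have "intermediate_curvature (warped_metric n m \<epsilon> F) p n m e
        - (sphere_curv x * W + stretch x * torus_const * (torus_grad lnF x \<bullet> torus_grad lnF x))
      = - (stretch x * (B + torus_const * (torus_grad lnF x \<bullet> torus_grad lnF x)))"
    unfolding C by (simp add: algebra_simps)
  with est have 1: "\<bar>intermediate_curvature (warped_metric n m \<epsilon> F) p n m e
        - (sphere_curv x * W + stretch x * torus_const * (torus_grad lnF x \<bullet> torus_grad lnF x))\<bar>
      \<le> stretch x * (9 * (real n)\<^sup>2 * form_bound * tilt)"
    by (simp only: abs_minus_cancel)
  have 2: "tilt = 0 \<and> W = 0" if e0: "\<And>i. i \<in> {1..m} \<Longrightarrow> fst (e i) = 0"
  proof -
    have a0: "a i = 0" if i: "i \<in> {1..m}" for i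
    proof -
      have "dstereo \<sigma> (fst z) (fst (u i)) = 0"
        using du[of i] e0[OF i] i mn by (simp add: dchart_dstereo prod_eq_iff)
      hence "(conformal_factor (fst z))\<^sup>2 * (fst (u i) \<bullet> fst (u i)) = 0"
        using dstereo_conformal[OF \<sigma>, of "fst z" "fst (u i)" "fst (u i)"] by simp
      hence "fst (u i) = 0" using conformal_factor_pos[of "fst z"] by simp
      thus ?thesis unfolding a_def v_def wc.rescale_def by simp
    qed
    thus ?thesis by (simp add: tilt_def W_def w_def)
  qed
  have 3: "W \<ge> (real n - real m - 1) / 2 * tilt"
    using spherical_part unfolding W_def w_def by (simp only: DIM_cart DIM_real mult_1_right k)
  have 4: "snd p = torus_pt x" using pz by (auto simp: chart_def x_def)
  show ?thesis by (rule that[OF 4 tilt_nonneg 3 2 1])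
qed

lemma torus_grad_lnF:
  "torus_grad lnF x \<bullet> torus_grad lnF x = (\<Sum>i\<in>UNIV. (torus_partial i F (torus_pt x))\<^sup>2) / (F (torus_pt x))\<^sup>2"
  using torus_ln(2)[OF smooth_F F_pos torus_pt_in]
  by (simp add: torus_grad_def inner_vec_def lnF_def[abs_def] power2_eq_square sum_divide_distrib)

lemma stretch_powr: "stretch x / (F (torus_pt x))\<^sup>2 = F (torus_pt x) powr (2 * c - 2)"
proof -
  have "F (torus_pt x) > 0" by (simp add: F_pos)
  moreover from this have "F (torus_pt x) powr (2 * c) = stretch x"
    by (simp add: powr_def stretch_def lnF_def)
  ultimately show ?thesis by (simp add: powr_diff powr_numeral)
qed

lemma torus_frame_curvature:
  fixes p :: "('k::finite, 'm) point"
  assumes dim: "CARD('k) = n - m" and p: "p \<in> sphere_torus"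
    and frame: "orthonormal_frame (warped_metric n m \<epsilon> F) p n e"
    and e0: "\<And>i. i \<in> {1..m} \<Longrightarrow> fst (e i) = 0"
  shows "intermediate_curvature (warped_metric n m \<epsilon> F) p n m e =
    torus_const * F (snd p) powr (2 * c - 2) * (\<Sum>i\<in>UNIV. (torus_partial i F (snd p))\<^sup>2)"
proof -
  obtain x S W where x: "snd p = torus_pt x"
    and 0: "(\<And>i. i \<in> {1..m} \<Longrightarrow> fst (e i) = 0) \<Longrightarrow> S = 0 \<and> W = 0"
    and est: "\<bar>intermediate_curvature (warped_metric n m \<epsilon> F) p n m e
        - (sphere_curv x * W + stretch x * torus_const * (torus_grad lnF x \<bullet> torus_grad lnF x))\<bar>
      \<le> stretch x * (9 * (real n)\<^sup>2 * form_bound * S)"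
    using intermediate_curvature_estimate[OF dim p frame] by metis
  from 0[OF e0] est show ?thesis
    by (simp add: torus_grad_lnF x flip: stretch_powr)
qed

text \<open>Chosen so that \<open>sphere_curv_large\<close> holds: the first summand in the parentheses pays for the gradient
in \<open>sphere_curv\<close>, the second for twice the error in \<open>intermediate_curvature_estimate\<close>, and
the exponential for the variation of \<open>F\<close>.\<close>

definition threshold :: real where
  "threshold = 1 + exp (2 * (1 + c) * C2_norm lnF) * ((C2_norm lnF)\<^sup>2 + 18 * (real n)\<^sup>2 * form_bound)"

lemma sphere_curv_large:
  assumes "1 / \<epsilon>\<^sup>2 \<ge> threshold"
  shows "sphere_curv x \<ge> stretch x * (18 * (real n)\<^sup>2 * form_bound)"
proof -
  define K where "K = C2_norm lnF"
  define y where "y = lnF (torus_pt x)"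
  let ?D = "K\<^sup>2 + 18 * (real n)\<^sup>2 * form_bound"
  have D: "?D \<ge> 0" using C2_norm_nonneg by (simp add: form_bound_def)
  have yK: "\<bar>y\<bar> \<le> K" unfolding y_def K_def by (rule C2.C2_bounds)
  have gg: "torus_grad lnF x \<bullet> torus_grad lnF x \<le> K\<^sup>2"
    using power_mono[OF C2.C2_bounds(2)[of x], of 2] by (simp add: K_def power2_norm_eq_inner)
  have "exp (2 * (1 + c) * K) * ?D \<le> 1 / \<epsilon>\<^sup>2"
    using assms by (simp add: threshold_def K_def)
  hence "exp (- 2 * y) * (exp (2 * (1 + c) * K) * ?D) \<le> exp (- 2 * y) * (1 / \<epsilon>\<^sup>2)"
    by (intro mult_left_mono) auto
  moreover have "stretch x \<le> exp (- 2 * y) * exp (2 * (1 + c) * K)"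
  proof -
    have "(1 + c) * y \<le> (1 + c) * K" using yK c_nonneg by (intro mult_left_mono) auto
    thus ?thesis by (simp add: stretch_def y_def[symmetric] algebra_simps flip: exp_add)
  qed
  hence "stretch x * ?D \<le> exp (- 2 * y) * exp (2 * (1 + c) * K) * ?D"
    using D by (rule mult_right_mono)
  ultimately have "stretch x * ?D \<le> exp (- 2 * y) / \<epsilon>\<^sup>2" by (simp add: mult.assoc)
  moreover have "stretch x * (torus_grad lnF x \<bullet> torus_grad lnF x) \<le> stretch x * K\<^sup>2"
    using gg by (intro mult_left_mono) (auto simp: stretch_def)
  ultimately show ?thesis by (simp add: sphere_curv_def y_def algebra_simps)
qed

text \<open>Since \<open>n - m - 1\<close> is at least one, \<open>W\<close> is at least half the tilt, and the spherical term absorbs the error.\<close>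

lemma intermediate_curvature_lower_bound:
  fixes p :: "('k::finite, 'm) point"
  assumes dim: "CARD('k) = n - m" and p: "p \<in> sphere_torus" and nm: "n \<ge> m + 2"
    and frame: "orthonormal_frame (warped_metric n m \<epsilon> F) p n e"
    and \<epsilon>: "1 / \<epsilon>\<^sup>2 \<ge> threshold"
  shows "intermediate_curvature (warped_metric n m \<epsilon> F) p n m e \<ge>
    torus_const * F (snd p) powr (2 * c - 2) * (\<Sum>i\<in>UNIV. (torus_partial i F (snd p))\<^sup>2)"
proof -
  obtain x S W where x: "snd p = torus_pt x" and S: "S \<ge> 0" and W: "W \<ge> (real n - real m - 1) / 2 * S"
    and est: "\<bar>intermediate_curvature (warped_metric n m \<epsilon> F) p n m e
        - (sphere_curv x * W + stretch x * torus_const * (torus_grad lnF x \<bullet> torus_grad lnF x))\<bar>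
      \<le> stretch x * (9 * (real n)\<^sup>2 * form_bound * S)"
    using intermediate_curvature_estimate[OF dim p frame] by metis
  define L where "L = stretch x * (18 * (real n)\<^sup>2 * form_bound)"
  have L: "L \<ge> 0" "sphere_curv x \<ge> L"
    using C2_norm_nonneg sphere_curv_large[OF \<epsilon>] by (simp_all add: L_def form_bound_def stretch_def)
  have "1 / 2 * S \<le> (real n - real m - 1) / 2 * S"
    using S nm by (intro mult_right_mono) auto
  hence W': "W \<ge> S / 2" using W by simp
  have "L * (S / 2) \<le> sphere_curv x * W"
    by (rule mult_mono) (use L W' S in auto)
  hence "stretch x * (9 * (real n)\<^sup>2 * form_bound * S) \<le> sphere_curv x * W"
    by (simp add: L_def mult_ac)
  with est have "intermediate_curvature (warped_metric n m \<epsilon> F) p n m e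
      \<ge> stretch x * torus_const * (torus_grad lnF x \<bullet> torus_grad lnF x)"
    by linarith
  thus ?thesis unfolding x stretch_powr[symmetric] torus_grad_lnF by (simp add: mult_ac)
qed

end

section \<open>Nonnegative intermediate curvature for small spheres\<close>

theorem theorem1p4:
  fixes m n :: nat
    and g :: "real \<Rightarrow> ((real^'m::finite) set \<Rightarrow> real) \<Rightarrow> ('k::finite, 'm) metric"
  assumes m: "m \<ge> 2" and n: "n \<ge> m + 2"
    and dim_torus: "CARD('m) = m" and dim_sphere: "CARD('k) = n - m"
    and g: "g = warped_metric n m"
  shows
    "(\<forall>F \<epsilon> \<iota> p e.
        torus_smooth F \<and> (\<forall>q\<in>torus. F q > 0) \<and> \<epsilon> > 0 \<and>
        p \<in> sphere_torus \<and> bij_betw \<iota> {1..m} (UNIV :: 'm set) \<and>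
        orthonormal_frame (g \<epsilon> F) p n e \<and>
        (\<forall>i\<in>{1..m}. e i = (1 / sqrt (g \<epsilon> F p (coord_vect (\<iota> i)) (coord_vect (\<iota> i))))
                              *\<^sub>R coord_vect (\<iota> i))
        \<longrightarrow> intermediate_curvature (g \<epsilon> F) p n m e =
              (real n - real m)
              * ((real n - real m) * (real m - 2) / (2 * (real m - 1)) - 1)
              * F (snd p) powr (2 * ((real n - real m) / (real m - 1)) - 2)
              * (\<Sum>i\<in>UNIV. (torus_partial i F (snd p))\<^sup>2))
     \<and>
     (int n * (int m - 2) \<ge> (int m)\<^sup>2 - 2 \<longrightarrow>
        (\<exists>\<epsilon>\<^sub>0 :: real \<Rightarrow> real. (\<forall>K. \<epsilon>\<^sub>0 K > 0) \<and>
          (\<forall>F \<epsilon>. torus_smooth F \<and> (\<forall>q\<in>torus. F q > 0) \<and>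
                 0 < \<epsilon> \<and> \<epsilon> < \<epsilon>\<^sub>0 (C2_norm (\<lambda>q. ln (F q))) \<longrightarrow>
            (\<forall>p\<in>sphere_torus. curvature_ge (g \<epsilon> F) p n m 0) \<and>
            (int n * (int m - 2) > (int m)\<^sup>2 - 2 \<longrightarrow>
              (\<forall>p\<in>sphere_torus. (\<exists>i. torus_partial i F (snd p) \<noteq> 0) \<longrightarrow>
                 curvature_pos (g \<epsilon> F) p n m)))))"
proof (intro conjI allI impI)
  fix F :: "(real^'m) set \<Rightarrow> real" and \<epsilon> :: real and \<iota> and p :: "('k, 'm) point" and e
  assume *: "torus_smooth F \<and> (\<forall>q\<in>torus. F q > 0) \<and> \<epsilon> > 0 \<and>
        p \<in> sphere_torus \<and> bij_betw \<iota> {1..m} (UNIV :: 'm set) \<and>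
        orthonormal_frame (g \<epsilon> F) p n e \<and>
        (\<forall>i\<in>{1..m}. e i = (1 / sqrt (g \<epsilon> F p (coord_vect (\<iota> i)) (coord_vect (\<iota> i))))
                              *\<^sub>R coord_vect (\<iota> i))"
  interpret warped_torus F \<epsilon> n m
    using * m n dim_torus by unfold_locales auto
  show "intermediate_curvature (g \<epsilon> F) p n m e =
              (real n - real m)
              * ((real n - real m) * (real m - 2) / (2 * (real m - 1)) - 1)
              * F (snd p) powr (2 * ((real n - real m) / (real m - 1)) - 2)
              * (\<Sum>i\<in>UNIV. (torus_partial i F (snd p))\<^sup>2)"
    unfolding g torus_const_def[symmetric] c_def[symmetric]
    by (rule torus_frame_curvature[OF dim_sphere]) (use * in \<open>auto simp: g coord_vect_def\<close>)
next
  assume dims: "int n * (int m - 2) \<ge> (int m)\<^sup>2 - 2"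
  define const where
    "const = (real n - real m) * ((real n - real m) * (real m - 2) / (2 * (real m - 1)) - 1)"
  \<comment> \<open>The sign of the constant is that of \<open>n (m - 2) - (m\<^sup>2 - 2)\<close>.\<close>
  have const: "const = (real n - real m) / (2 * (real m - 1)) * real_of_int (int n * (int m - 2) - ((int m)\<^sup>2 - 2))"
    using m by (simp add: const_def field_simps power2_eq_square)
  have fac: "(real n - real m) / (2 * (real m - 1)) > 0" using m n by simp
  have const_nonneg: "const \<ge> 0"
    unfolding const by (rule mult_nonneg_nonneg) (use fac dims in linarith)+
  define c where "c = (real n - real m) / (real m - 1)"
  \<comment> \<open>The threshold as a function of the norm alone. Absolute values make it positive on all reals.\<close>
  define D where "D K = 1 + exp (2 * (1 + c) * \<bar>K\<bar>) * (\<bar>K\<bar>\<^sup>2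
      + 18 * (real n)\<^sup>2 * ((1 + c)\<^sup>2 * (\<bar>K\<bar> + 3 * \<bar>K\<bar>\<^sup>2)))" for K :: real
  have D: "D K > 0" for K unfolding D_def by (rule add_pos_nonneg) auto
  define \<epsilon>0 where "\<epsilon>0 K = 1 / sqrt (D K)" for K
  show "\<exists>\<epsilon>\<^sub>0 :: real \<Rightarrow> real. (\<forall>K. \<epsilon>\<^sub>0 K > 0) \<and>
          (\<forall>F \<epsilon>. torus_smooth F \<and> (\<forall>q\<in>torus. F q > 0) \<and>
                 0 < \<epsilon> \<and> \<epsilon> < \<epsilon>\<^sub>0 (C2_norm (\<lambda>q. ln (F q))) \<longrightarrow>
            (\<forall>p\<in>sphere_torus. curvature_ge (g \<epsilon> F) p n m 0) \<and>
            (int n * (int m - 2) > (int m)\<^sup>2 - 2 \<longrightarrow>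
              (\<forall>p\<in>sphere_torus. (\<exists>i. torus_partial i F (snd p) \<noteq> 0) \<longrightarrow>
                 curvature_pos (g \<epsilon> F) p n m)))"
  proof (intro exI[of _ \<epsilon>0] conjI allI impI ballI)
    show "\<epsilon>0 K > 0" for K using D by (simp add: \<epsilon>0_def)
  next
    fix F :: "(real^'m) set \<Rightarrow> real" and \<epsilon> :: real
    assume *: "torus_smooth F \<and> (\<forall>q\<in>torus. F q > 0) \<and>
                 0 < \<epsilon> \<and> \<epsilon> < \<epsilon>0 (C2_norm (\<lambda>q. ln (F q)))"
    interpret W: warped_torus F \<epsilon> n m
      using * m n dim_torus by unfold_locales auto
    have cc: "W.c = c" "W.torus_const = const"
      by (simp_all add: W.c_def c_def W.torus_const_def const_def)
    have thr: "W.threshold = D (C2_norm W.lnF)"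
      using W.C2_norm_nonneg by (simp add: W.threshold_def D_def W.form_bound_def cc)
    have "1 / \<epsilon>\<^sup>2 \<ge> W.threshold"
    proof -
      have "\<epsilon> \<le> 1 / sqrt (D (C2_norm W.lnF))"
        using * by (simp add: \<epsilon>0_def W.lnF_def[abs_def])
      hence "\<epsilon>\<^sup>2 \<le> (1 / sqrt (D (C2_norm W.lnF)))\<^sup>2"
        using * by (intro power_mono) auto
      hence "\<epsilon>\<^sup>2 \<le> 1 / D (C2_norm W.lnF)"
        using D[of "C2_norm W.lnF"] by (simp add: power_divide)
      thus ?thesis using * D[of "C2_norm W.lnF"] by (simp add: thr field_simps)
    qed
    note lower = W.intermediate_curvature_lower_bound[OF dim_sphere _ n _ this, unfolded cc]
    have sum_nonneg': "(\<Sum>i\<in>UNIV. (torus_partial i F q)\<^sup>2) \<ge> 0" for q by (simp add: sum_nonneg)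
    show "curvature_ge (g \<epsilon> F) p n m 0" if p: "p \<in> sphere_torus" for p
      unfolding curvature_ge_def g
    proof (intro allI impI order_trans[OF _ lower[OF p]])
      show "0 \<le> const * F (snd p) powr (2 * c - 2) * (\<Sum>i\<in>UNIV. (torus_partial i F (snd p))\<^sup>2)"
        using const_nonneg sum_nonneg' by simp
    qed
    show "curvature_pos (g \<epsilon> F) p n m"
      if strict: "int n * (int m - 2) > (int m)\<^sup>2 - 2" and p: "p \<in> sphere_torus"
        and noncrit: "\<exists>i. torus_partial i F (snd p) \<noteq> 0" for p
      unfolding curvature_pos_def g
    proof (intro allI impI less_le_trans[OF _ lower[OF p]])
      have "const > 0"
        unfolding const by (rule mult_pos_pos[OF fac]) (use strict in linarith)
      moreover have "F (snd p) > 0" using * p by (auto simp: sphere_torus_def)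
      moreover obtain i where "torus_partial i F (snd p) \<noteq> 0" using noncrit by blast
      hence "(\<Sum>i\<in>UNIV. (torus_partial i F (snd p))\<^sup>2) > 0"
        by (intro sum_pos2[of _ i]) auto
      ultimately show "0 < const * F (snd p) powr (2 * c - 2) * (\<Sum>i\<in>UNIV. (torus_partial i F (snd p))\<^sup>2)"
        by simp
    qed
  qed
qed

end
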